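(* Consider the coupled network $$\tilde x_{t+1}=\left(\tilde A-(L_g(\Xi)\otimes GC)\right)\tilde x_t-\tilde B\tilde\phi(\tilde y_t)+v_t,\qquad \tilde y_t=\tilde C\tilde x_t .$$ It is mean square exponentially synchronizing if there exists a symmetric positive definite matrix $\mathcal P\in\mathbb{R}^{(N-1)n\times(N-1)n}$ such that $\hat\Sigma_1-\hat B^\top\mathcal P\hat B>0$ and $$\begin{aligned}\mathcal P=&(\hat A_0-\hat\Lambda_m\otimes GC)^\top\mathcal P(\hat A_0-\hat\Lambda_m\otimes GC)+\sum_{k=1}^{M}\sigma_{\alpha_k}^2A_{\alpha_k}^\top\mathcal PA_{\alpha_k}\\&+(\hat A_0-\hat\Lambda_m\otimes GC)^\top\mathcal P\hat B(\hat\Sigma_1-\hat B^\top\mathcal P\hat B)^{-1}\hat B^\top\mathcal P(\hat A_0-\hat\Lambda_m\otimes GC)\\&+\sum_{k=1}^{M}\sigma_{\alpha_k}^2A_{\alpha_k}^\top\mathcal P\hat B(\hat\Sigma_1-\hat B^\top\mathcal P\hat B)^{-1}\hat B^\top\mathcal PA_{\alpha_k}+\hat C^\top\hat\Sigma_1^{-1}\hat C+\mathcal R\end{aligned}$$ for some symmetric matrix $\mathcal R>0$, where $\hat A_0:=\hat A-\hat B\hat\Sigma_1^{-1}\hat C=I_{N-1}\otimes A_0$ and $A_0=A-B\Sigma_1^{-1}C$.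
   Context: There are $N$ identical subsystems with states $x^k_t\in\mathbb{R}^n$ and outputs $y^k_t=Cx^k_t\in\mathbb{R}^m$; $A\in\mathbb{R}^{n\times n}$, $B\in\mathbb{R}^{n\times m}$, $C\in\mathbb{R}^{m\times n}$, $G\in\mathbb{R}^{n\times m}$. Stacked: $\tilde x_t=[(x^1_t)^\top\cdots(x^N_t)^\top]^\top$, $\tilde y_t=[(y^1_t)^\top\cdots(y^N_t)^\top]^\top$, $\tilde\phi(\tilde y_t)=[\phi(y^1_t,t)^\top\cdots\phi(y^N_t,t)^\top]^\top$, $\tilde A=I_N\otimes A$, $\tilde B=I_N\otimes B$, $\tilde C=I_N\otimes C$. $v_t\in\mathbb{R}^{Nn}$ is zero-mean additive noise with covariance $R_v$. Nonlinearity: $\phi(\cdot,t):\mathbb{R}^m\to\mathbb{R}^m$ is globally Lipschitz, $C^1$ and monotonically nondecreasing; for some $D\in\mathbb{R}^{m\times m}$, $\phi(y,t)^\top(y-D\phi(y,t))>0$ for $y\ne0$ (and $\ge0$ at $y=0$); and for some $D_1\in\mathbb{R}^{m\times m}$ with $\Sigma_1=D_1+D_1^\top>0$, $(\phi(y,t)-\phi(y',t))^\top\left((y-y')-D_1(\phi(y,t)-\phi(y',t))\right)>0$ for $y\neq y'$. Network: the weighted graph is undirected with mean weights $\mu_{ij}=\mu_{ji}$. $E_U$ is the set of uncertain links $(i,j)$, $i>j$; the weight of $(i,j)\in E_U$ is $\mu_{ij}+\xi_{ij}(t)$, with $\xi_{ij}(t)$ zero-mean i.i.d. (in time), mutually independent,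 of variance $\sigma_{ij}^2$; the other links are deterministic. $L_g(\Xi)=L_m+\sum_{(i,j)\in E_U}\xi_{ij}\ell_{ij}\ell_{ij}^\top$, where $L_m$ is the nominal (mean) Laplacian (off-diagonal entries $-\mu_{ij}$, zero row sums) and $\ell_{ij}\in\mathbb{R}^N$ has entry $1$ at $i$, $-1$ at $j$ and $0$ elsewhere. $L_m=V_m\Lambda_mV_m^\top$ with $\Lambda_m$ diagonal and $V_m=[\mathbf 1/\sqrt N\;\;U_m]$ orthogonal, $\mathbf 1=[1\cdots1]^\top$; $\hat\Lambda_m=U_m^\top L_mU_m$. $\alpha_1,\dots,\alpha_M$, $M=|E_U|$, enumerate $E_U$; for $\alpha_k$ corresponding to $(i,j)$, $\sigma_{\alpha_k}^2=\sigma_{ij}^2$ and $A_{\alpha_k}=\hat\ell_{ij}\hat\ell_{ij}^\top\otimes GC$ with $\hat\ell_{ij}=U_m^\top\ell_{ij}$. $\hat A=I_{N-1}\otimes A$, $\hat B=I_{N-1}\otimes B$, $\hat C=I_{N-1}\otimes C$, $\hat\Sigma_1=I_{N-1}\otimes\Sigma_1$. Mean square exponential synchronization of the network: there exist $0<\beta<1$, $\bar K(\tilde e_0)>0$ and $c>0$ such that $E\|x^k_t-x^j_t\|^2\le\bar K(\tilde e_0)\beta^t\|x^k_0-x^j_0\|^2+c\|R_v\|$ for all $k,j\in\{1,\dots,N\}$, where $\tilde e_0$ is a function of the differences $\|x^i_0-x^\ell_0\|^2$, $i,\ell\in\{1,\dots,N\}$, and $\bar K(0)=K$ for some constant $K$.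 Expectations are over all randomness driving the system.
   Formalization: The additive noise v_t is assumed independent of the link uncertainties ξ_ij; and for a pair with x^k_0 = x^j_0 while not all initial states agree, the zero factor ‖x^k_0−x^j_0‖² in the synchronization bound is replaced by 1. The claim fails without these changes. *)

theory Defs
  imports "HOL-Probability.Probability"
begin

section \<open>Matrices\<close>

text \<open>An \<open>r \<times> s\<close> matrix has type \<^typ>\<open>real^'s^'r\<close>. Block vectors and block matrices are indexed by
  pairs, the first component being the number of the block.\<close>

definition kron :: "real^'b^'a \<Rightarrow> real^'d^'c \<Rightarrow> real^('b::finite \<times> 'd::finite)^('a::finite \<times> 'c::finite)" where
  "kron X Y = (\<chi> p q. X $ fst p $ fst q * Y $ snd p $ snd q)"

definition blk :: "real^'d^'c \<Rightarrow> real^('k::finite \<times> 'd::finite)^('k::finite \<times> 'c::finite)" where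
  "blk Y = kron (mat 1 :: real^'k^'k) Y"

definition outer :: "real^'a \<Rightarrow> real^'a^'a" where
  "outer u = (\<chi> i j. u $ i * u $ j)"

definition pos_def :: "real^'a^'a \<Rightarrow> bool" where
  "pos_def X \<longleftrightarrow> transpose X = X \<and> (\<forall>u. u \<noteq> 0 \<longrightarrow> u \<bullet> (X *v u) > 0)"

text \<open>Norm of a square matrix induced by the Euclidean norm (\<^const>\<open>norm\<close> on \<^typ>\<open>real^'a^'a\<close> is the
  Frobenius norm).\<close>

definition mat_norm :: "real^'a^'a \<Rightarrow> real" where
  "mat_norm X = onorm (\<lambda>u. X *v u)"

section \<open>Nonlinearity\<close>

definition C1_map :: "(real^'m \<Rightarrow> real^'m) \<Rightarrow> bool" where
  "C1_map f \<longleftrightarrow> (\<exists>f' :: real^'m \<Rightarrow> (real^'m) \<Rightarrow>\<^sub>L (real^'m).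
      (\<forall>y. (f has_derivative blinfun_apply (f' y)) (at y)) \<and> continuous_on UNIV f')"

text \<open>For a vector field, monotonically nondecreasing is read in the sense of monotone operators.\<close>

definition monotone_operator :: "(real^'m \<Rightarrow> real^'m) \<Rightarrow> bool" where
  "monotone_operator f \<longleftrightarrow> (\<forall>y y'. (f y - f y') \<bullet> (y - y') \<ge> 0)"

definition sector_condition :: "real^'m^'m \<Rightarrow> (real^'m \<Rightarrow> real^'m) \<Rightarrow> bool" where
  "sector_condition D f \<longleftrightarrow>
     (\<forall>y. y \<noteq> 0 \<longrightarrow> f y \<bullet> (y - D *v f y) > 0) \<and> f 0 \<bullet> (0 - D *v f 0) \<ge> 0"

definition incremental_condition :: "real^'m^'m \<Rightarrow> (real^'m \<Rightarrow> real^'m) \<Rightarrow> bool" where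
  "incremental_condition D f \<longleftrightarrow>
     (\<forall>y y'. y \<noteq> y' \<longrightarrow> (f y - f y') \<bullet> ((y - y') - D *v (f y - f y')) > 0)"

section \<open>Network\<close>

definition subsys :: "'N \<Rightarrow> real^('N::finite \<times> 'k::finite) \<Rightarrow> real^'k" where
  "subsys i z = (\<chi> a. z $ (i, a))"

definition stack_map :: "(real^'m \<Rightarrow> real^'m) \<Rightarrow> real^('N::finite \<times> 'm::finite) \<Rightarrow> real^('N::finite \<times> 'm::finite)" where
  "stack_map f z = (\<chi> p. f (subsys (fst p) z) $ snd p)"

definition laplacian :: "('N \<Rightarrow> 'N \<Rightarrow> real) \<Rightarrow> real^'N^'N" where
  "laplacian \<mu> = (\<chi> i j. if i = j then (\<Sum>k\<in>UNIV - {i}. \<mu> i k) else - \<mu> i j)"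

definition link_vec :: "'N \<times> 'N \<Rightarrow> real^'N" where
  "link_vec e = (\<chi> i. if i = fst e then 1 else if i = snd e then -1 else 0)"

definition random_laplacian ::
    "('N \<Rightarrow> 'N \<Rightarrow> real) \<Rightarrow> ('N \<times> 'N) set \<Rightarrow> ('N \<times> 'N \<Rightarrow> real) \<Rightarrow> real^'N^'N" where
  "random_laplacian \<mu> EU \<Xi> = laplacian \<mu> + (\<Sum>e\<in>EU. \<Xi> e *\<^sub>R outer (link_vec e))"

text \<open>Solution of the coupled network started at the deterministic initial state \<open>x0\<close>.\<close>

primrec network_state ::
    "real^'n^'n \<Rightarrow> real^'m^'n \<Rightarrow> real^'n^'m \<Rightarrow> real^'m^'n \<Rightarrow> (real^'m \<Rightarrow> nat \<Rightarrow> real^'m)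
     \<Rightarrow> ('N \<Rightarrow> 'N \<Rightarrow> real) \<Rightarrow> ('N \<times> 'N) set \<Rightarrow> ('N \<times> 'N \<Rightarrow> nat \<Rightarrow> 'w \<Rightarrow> real)
     \<Rightarrow> (nat \<Rightarrow> 'w \<Rightarrow> real^('N::finite \<times> 'n::finite)) \<Rightarrow> real^('N::finite \<times> 'n::finite) \<Rightarrow> nat \<Rightarrow> 'w \<Rightarrow> real^('N::finite \<times> 'n::finite)" where
  "network_state A B C G \<phi> \<mu> EU \<xi> v x0 0 \<omega> = x0"
| "network_state A B C G \<phi> \<mu> EU \<xi> v x0 (Suc t) \<omega> =
     (let x = network_state A B C G \<phi> \<mu> EU \<xi> v x0 t \<omega>; y = blk C *v x
      in (blk A - kron (random_laplacian \<mu> EU (\<lambda>e. \<xi> e t \<omega>)) (G ** C)) *v x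
         - blk B *v stack_map (\<lambda>z. \<phi> z t) y + v t \<omega>)"

text \<open>\<open>V = [\<one>/sqrt N  U]\<close>: the column \<^const>\<open>None\<close> is the normalised all-ones vector, the column \<open>Some j\<close> is
  column \<open>j\<close> of \<open>U\<close>.\<close>

definition bordered :: "real^'q^'N \<Rightarrow> real^('q::finite option)^'N" where
  "bordered U = (\<chi> i c. case c of None \<Rightarrow> 1 / sqrt (real CARD('N)) | Some j \<Rightarrow> U $ i $ j)"

text \<open>\<open>L = V \<Lambda> V\<^sup>T\<close> with \<open>V = [\<one>/sqrt N  U]\<close> orthogonal and \<open>\<Lambda>\<close> diagonal. The two index types of \<open>V\<close> have the
  same cardinality but are distinct types, hence the two explicit orthogonality equations.\<close>

definition diagonalized_by :: "real^'N^'N \<Rightarrow> real^'q^'N \<Rightarrow> bool" where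
  "diagonalized_by L U \<longleftrightarrow>
     transpose (bordered U) ** bordered U = mat 1 \<and>
     bordered U ** transpose (bordered U) = mat 1 \<and>
     (\<exists>\<Lambda>. (\<forall>a b. a \<noteq> b \<longrightarrow> \<Lambda> $ a $ b = 0) \<and> L = bordered U ** \<Lambda> ** transpose (bordered U))"

section \<open>Randomness\<close>

text \<open>\<open>\<xi> e t\<close>, for \<open>e \<in> EU\<close>: zero mean, variance \<open>\<sigma> e\<^sup>2\<close>, identically distributed in time, and mutually
  independent over all links and all times.\<close>

definition link_noise ::
    "'w measure \<Rightarrow> 'e set \<Rightarrow> ('e \<Rightarrow> real) \<Rightarrow> ('e \<Rightarrow> nat \<Rightarrow> 'w \<Rightarrow> real) \<Rightarrow> bool" where
  "link_noise M EU \<sigma> \<xi> \<longleftrightarrow>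
     prob_space.indep_vars M (\<lambda>_. borel) (\<lambda>p. \<xi> (fst p) (snd p)) (EU \<times> UNIV) \<and>
     (\<forall>e\<in>EU. \<forall>t. distr M borel (\<xi> e t) = distr M borel (\<xi> e 0) \<and>
        integrable M (\<lambda>\<omega>. (\<xi> e t \<omega>)\<^sup>2) \<and>
        prob_space.expectation M (\<xi> e t) = 0 \<and>
        prob_space.variance M (\<xi> e t) = (\<sigma> e)\<^sup>2)"

definition additive_noise ::
    "'w measure \<Rightarrow> real^'a^'a \<Rightarrow> (nat \<Rightarrow> 'w \<Rightarrow> real^'a) \<Rightarrow> bool" where
  "additive_noise M R v \<longleftrightarrow>
     (\<forall>t. v t \<in> borel_measurable M \<and> integrable M (\<lambda>\<omega>. (norm (v t \<omega>))\<^sup>2) \<and>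
        prob_space.expectation M (v t) = 0 \<and>
        (\<forall>i j. prob_space.expectation M (\<lambda>\<omega>. v t \<omega> $ i * v t \<omega> $ j) = R $ i $ j))"

text \<open>The additive noise process is independent of the link noise process (independence of the generated
  sigma-algebras).\<close>

definition noises_independent ::
    "'w measure \<Rightarrow> 'e set \<Rightarrow> ('e \<Rightarrow> nat \<Rightarrow> 'w \<Rightarrow> real) \<Rightarrow> (nat \<Rightarrow> 'w \<Rightarrow> real^'a) \<Rightarrow> bool" where
  "noises_independent M EU \<xi> v \<longleftrightarrow>
     prob_space.indep_set M
       (sets (vimage_algebra (space M) (\<lambda>\<omega>. \<lambda>p\<in>EU \<times> UNIV. \<xi> (fst p) (snd p) \<omega>)
                (PiM (EU \<times> UNIV) (\<lambda>_. borel))))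
       (sets (vimage_algebra (space M) (\<lambda>\<omega> t. v t \<omega>) (PiM UNIV (\<lambda>_. borel))))"

section \<open>Mean square exponential synchronization\<close>

definition sq_dist :: "real^('N::finite \<times> 'n::finite) \<Rightarrow> 'N \<Rightarrow> 'N \<Rightarrow> real" where
  "sq_dist z i l = (norm (subsys i z - subsys l z))\<^sup>2"

text \<open>
  \<open>X x0 t \<omega>\<close> is the state at time \<open>t\<close> of the network started at \<open>x0\<close>. The gain \<open>Kb\<close> is a function of the
  initial squared differences \<open>sq_dist x0\<close>.

  If two subsystems start at the same state while some others do not, then \<open>Kb (sq_dist x0) * \<beta>^t *
  sq_dist x0 k j\<close> is zero whatever \<open>Kb\<close> is, although the coupling in general drives these two subsystems
  apart in the first step; without additive noise no \<open>Kb\<close> could then satisfy the bound. For such pairs, and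
  only for them, the vanishing factor \<open>sq_dist x0 k j\<close> is left out.\<close>

definition initial_factor :: "real^('N::finite \<times> 'n::finite) \<Rightarrow> 'N \<Rightarrow> 'N \<Rightarrow> real" where
  "initial_factor x0 k j =
     (if sq_dist x0 k j = 0 \<and> (\<exists>i l. sq_dist x0 i l \<noteq> 0) then 1 else sq_dist x0 k j)"

definition ms_exp_synchronizing ::
    "'w measure \<Rightarrow> real^('N::finite \<times> 'n::finite)^('N::finite \<times> 'n::finite)
     \<Rightarrow> (real^('N::finite \<times> 'n::finite) \<Rightarrow> nat \<Rightarrow> 'w \<Rightarrow> real^('N::finite \<times> 'n::finite)) \<Rightarrow> bool" where
  "ms_exp_synchronizing M R X \<longleftrightarrow>
     (\<exists>\<beta> c K. \<exists>Kb :: ('N \<Rightarrow> 'N \<Rightarrow> real) \<Rightarrow> real.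
        0 < \<beta> \<and> \<beta> < 1 \<and> 0 < c \<and> (\<forall>d. 0 < Kb d) \<and> Kb (\<lambda>_ _. 0) = K \<and>
        (\<forall>x0 t k j.
           integrable M (\<lambda>\<omega>. sq_dist (X x0 t \<omega>) k j) \<and>
           prob_space.expectation M (\<lambda>\<omega>. sq_dist (X x0 t \<omega>) k j)
             \<le> Kb (sq_dist x0) * \<beta> ^ t * initial_factor x0 k j + c * mat_norm R))"

section \<open>Riccati equation\<close>

definition riccati_rhs ::
    "real^'s^'s \<Rightarrow> real^'r^'s \<Rightarrow> real^'s^'r \<Rightarrow> real^'r^'r \<Rightarrow> 'e set \<Rightarrow> ('e \<Rightarrow> real)
     \<Rightarrow> ('e \<Rightarrow> real^'s^'s) \<Rightarrow> real^'s^'s \<Rightarrow> real^'s^'s \<Rightarrow> real^'s^'s" where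
  "riccati_rhs F Bh Ch Sh EU \<sigma> Ae P R =
     (let W = matrix_inv (Sh - transpose Bh ** P ** Bh) in
       transpose F ** P ** F
     + (\<Sum>e\<in>EU. (\<sigma> e)\<^sup>2 *\<^sub>R (transpose (Ae e) ** P ** Ae e))
     + transpose F ** P ** Bh ** W ** transpose Bh ** P ** F
     + (\<Sum>e\<in>EU. (\<sigma> e)\<^sup>2 *\<^sub>R (transpose (Ae e) ** P ** Bh ** W ** transpose Bh ** P ** Ae e))
     + transpose Ch ** matrix_inv Sh ** Ch
     + R)"

end

theory Submission
  imports Defs
begin

text \<open>
  Write \<open>T = U\<^sup>T \<otimes> I\<close> and \<open>z = T x\<close>. Since \<open>[\<one>/sqrt N  U]\<close> is orthogonal, \<open>z\<close> collects the components of the state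
  off the synchronization subspace, and \<open>2 N (T u \<bullet> T w)\<close> is the sum of \<open>(u\<^sub>i - u\<^sub>j) \<bullet> (w\<^sub>i - w\<^sub>j)\<close> over all pairs
  \<open>i, j\<close> (\<open>inner_disagreement\<close>). This identity makes \<open>\<parallel>z\<parallel>\<^sup>2\<close> equivalent to the squared
  differences of the subsystems, and it turns the incremental condition on \<open>\<phi>\<close> into a quadratic sector inequality between
  \<open>T y\<close> and the stacked nonlinearity \<open>f = T \<phi>(y)\<close> (\<open>disagreement_sector\<close>). Every realisation \<open>L\<close> of the
  Laplacian annihilates \<open>\<one>\<close>, hence \<open>L U U\<^sup>T = L\<close>, which gives a closed equation for \<open>z\<close>,
  \<open>z' = (\<Acirc> - \<Lambda> \<otimes> GC) z - B f - \<Sum> \<xi>\<^sub>e A\<^sub>e z + T v\<close> (\<open>disagreement_random_laplacian\<close>).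

  The Lyapunov function is \<open>z \<bullet> P z\<close>. Substituting \<open>g = \<Sigma>\<^sup>-\<^sup>1 C z - f\<close> centres the sector: \<open>-B f\<close> becomes \<open>B g\<close> plus the
  shift that turns \<open>A\<close> into \<open>A\<^sub>0\<close>, and the sector inequality becomes \<open>g \<bullet> \<Sigma> g \<le> C z \<bullet> \<Sigma>\<^sup>-\<^sup>1 C z\<close>. Maximising over \<open>g\<close>
  by completing the square produces the feedback term and the output term of the Riccati equation, so the drift part together with the
  variance terms \<open>\<sigma>\<^sub>e\<^sup>2 A\<^sub>e\<^sup>T P A\<^sub>e\<close> loses at least \<open>z \<bullet> R z\<close>, hence a fixed fraction of \<open>z \<bullet> P z\<close>
  (\<open>lyapunov_mean_decrease\<close>, \<open>pos_def_contraction\<close>).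

  The variance terms are what the link noise contributes in the mean: the link weights at time \<open>t\<close> are independent
  of the state at time \<open>t\<close>, which is a function of the earlier link weights and the additive noise
  (\<open>link_noise_indep_history\<close>), so all terms linear in \<open>\<xi>\<close> and all mixed products vanish
  (\<open>expectation_qform_random_combination\<close>). The additive noise may be correlated with the state through its own past;
  its cross term is absorbed by Young's inequality at the price of a slightly larger contraction factor \<open>\<beta> < 1\<close>. This
  gives \<open>E V\<^sub>t\<^sub>+\<^sub>1 \<le> \<beta> E V\<^sub>t + const * \<parallel>R\<^sub>v\<parallel>\<close>, and iterating it gives the bound.
\<close>

section \<open>Quadratic forms\<close>

definition qform :: "real^'a^'a \<Rightarrow> real^'a \<Rightarrow> real" where
  "qform P u = u \<bullet> (P *v u)"

lemma matrix_vector_mult_uminus: "X *v (- u) = - (X *v (u :: real^'a))"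
  using matrix_vector_mult_scaleR[of X "-1" u] by simp

lemma inner_transpose_mult: "u \<bullet> (transpose X *v w) = (X *v u) \<bullet> (w :: real^'a)"
  by (metis dot_lmul_matrix inner_commute transpose_matrix_vector)

lemma inner_symmetric_mult:
  assumes "transpose P = P"
  shows "u \<bullet> (P *v w) = w \<bullet> (P *v (u :: real^'a))"
  using inner_transpose_mult[of u P w] assms by (simp add: inner_commute)

lemma qform_add:
  assumes "transpose P = P"
  shows "qform P (u + w) = qform P u + 2 * (u \<bullet> (P *v w)) + qform P w"
  using inner_symmetric_mult[OF assms, of w u]
  by (simp add: qform_def matrix_vector_right_distrib inner_add_left inner_add_right)

lemma qform_scaleR: "qform P (c *\<^sub>R u) = c\<^sup>2 * qform P u"
  by (simp add: qform_def matrix_vector_mult_scaleR power2_eq_square)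

lemma qform_transpose_mult: "qform (transpose X ** P ** X) u = qform P (X *v u)"
proof -
  have "(transpose X ** P ** X) *v u = transpose X *v (P *v (X *v u))"
    by (simp only: matrix_vector_mul_assoc matrix_mul_assoc)
  then show ?thesis by (simp only: qform_def inner_transpose_mult)
qed

lemma pos_def_symmetric: "pos_def P \<Longrightarrow> transpose P = P"
  by (simp add: pos_def_def)

lemma pos_def_qform_pos: "pos_def P \<Longrightarrow> u \<noteq> 0 \<Longrightarrow> 0 < qform P u"
  by (simp add: pos_def_def qform_def)

lemma pos_def_qform_nonneg: "pos_def P \<Longrightarrow> 0 \<le> qform P u"
  using pos_def_qform_pos[of P u] by (cases "u = 0") (auto simp: qform_def)

text \<open>The form is nonnegative at \<open>sqrt \<epsilon> u - w / sqrt \<epsilon>\<close>, which bounds the cross term. In the recursion for the state, \<open>w\<close> is the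
  additive noise, and the mean of the cross term need not vanish.\<close>

lemma qform_young:
  assumes P: "pos_def P" and \<epsilon>: "\<epsilon> > 0"
  shows "qform P (u + w) \<le> (1 + \<epsilon>) * qform P u + (1 + 1 / \<epsilon>) * qform P w"
proof -
  have sym: "transpose P = P" by (rule pos_def_symmetric[OF P])
  have "0 \<le> qform P (sqrt \<epsilon> *\<^sub>R u + (- 1 / sqrt \<epsilon>) *\<^sub>R w)"
    by (rule pos_def_qform_nonneg[OF P])
  also have "\<dots> = \<epsilon> * qform P u - 2 * (u \<bullet> (P *v w)) + 1 / \<epsilon> * qform P w"
    unfolding qform_add[OF sym] qform_scaleR matrix_vector_mult_scaleR using \<epsilon> by (simp add: power_divide)
  finally show ?thesis
    by (simp add: qform_add[OF sym] algebra_simps)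
qed

text \<open>The form attains a positive minimum on the unit sphere, which homogeneity carries to the whole space.\<close>

lemma pos_def_qform_lower:
  fixes P :: "real^'a^'a"
  assumes P: "pos_def P"
  obtains a where "a > 0" "\<And>u. a * (norm u)\<^sup>2 \<le> qform P u"
proof -
  have c: "continuous_on (sphere 0 1) (qform P)"
    unfolding qform_def
    by (intro continuous_on_inner continuous_on_id linear_continuous_on matrix_vector_mul_bounded_linear)
  have ne: "sphere (0::real^'a) 1 \<noteq> {}" by simp
  obtain u0 where u0: "u0 \<in> sphere 0 1" "\<And>u. u \<in> sphere 0 1 \<Longrightarrow> qform P u0 \<le> qform P u"
    using continuous_attains_inf[OF compact_sphere ne c] by blast
  have pos: "qform P u0 > 0"
    using u0(1) by (intro pos_def_qform_pos[OF P]) auto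
  have "qform P u0 * (norm u)\<^sup>2 \<le> qform P u" for u
  proof (cases "u = 0")
    case False
    then have "qform P u0 \<le> qform P ((1 / norm u) *\<^sub>R u)" by (intro u0(2)) simp
    then show ?thesis using False by (simp add: qform_scaleR power_divide field_simps)
  qed (simp add: qform_def)
  with pos show ?thesis by (rule that)
qed

lemma qform_upper:
  fixes P :: "real^'a^'a"
  shows "qform P u \<le> mat_norm P * (norm u)\<^sup>2"
proof -
  have "qform P u \<le> norm u * norm (P *v u)"
    unfolding qform_def by (rule norm_cauchy_schwarz)
  also have "\<dots> \<le> norm u * (mat_norm P * norm u)"
    unfolding mat_norm_def
    by (intro mult_left_mono onorm matrix_vector_mul_bounded_linear) simp
  finally show ?thesis by (simp add: power2_eq_square mult_ac)
qed

lemma mat_norm_nonneg: "0 \<le> mat_norm P"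
  unfolding mat_norm_def by (intro onorm_pos_le matrix_vector_mul_bounded_linear)

lemma pos_def_invertible:
  assumes "pos_def S"
  shows "invertible S"
proof -
  have "u = 0" if "S *v u = 0" for u
    using that pos_def_qform_pos[OF assms, of u] by (auto simp: qform_def)
  then show ?thesis
    unfolding invertible_left_inverse matrix_left_invertible_ker by blast
qed

lemma matrix_inv_cancel:
  fixes S :: "real^'a^'a"
  assumes "invertible S"
  shows "S *v (matrix_inv S *v u) = u" "matrix_inv S *v (S *v u) = u"
proof -
  have "S ** matrix_inv S = mat 1 \<and> matrix_inv S ** S = mat 1"
    using assms unfolding invertible_def matrix_inv_def by (rule someI_ex)
  then show "S *v (matrix_inv S *v u) = u" "matrix_inv S *v (S *v u) = u"
    by (simp_all add: matrix_vector_mul_assoc)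
qed

lemma qform_matrix_inv_nonneg:
  assumes "pos_def S"
  shows "0 \<le> qform (matrix_inv S) u"
  using pos_def_qform_nonneg[OF assms, of "matrix_inv S *v u"]
  by (simp add: qform_def matrix_inv_cancel[OF pos_def_invertible[OF assms]] inner_commute)

text \<open>This is the nonnegativity of \<open>qform S (g - S\<^sup>-\<^sup>1 h)\<close>; the right-hand side is the maximum of the left-hand side
  over \<open>g\<close>, attained at \<open>g = S\<^sup>-\<^sup>1 h\<close>.\<close>

lemma complete_the_square:
  assumes S: "pos_def S"
  shows "2 * (g \<bullet> h) - qform S g \<le> qform (matrix_inv S) h"
proof -
  note cancel = matrix_inv_cancel[OF pos_def_invertible[OF S]]
  have "0 \<le> qform S (g + - (matrix_inv S *v h))" by (rule pos_def_qform_nonneg[OF S])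
  also have "\<dots> = qform S g - 2 * (g \<bullet> h) + qform (matrix_inv S) h"
    unfolding qform_add[OF pos_def_symmetric[OF S]]
    by (simp add: matrix_vector_mult_uminus cancel) (simp add: qform_def cancel matrix_vector_mult_uminus inner_commute)
  finally show ?thesis by simp
qed

section \<open>Decrease from the Riccati equation\<close>

lemma qform_matrix_add: "qform (X + Y) u = qform X u + qform Y u"
  by (simp add: qform_def matrix_vector_mult_add_rdistrib inner_add_right)

lemma qform_matrix_diff: "qform (X - Y) u = qform X u - qform Y u"
  by (simp add: qform_def matrix_vector_mult_diff_rdistrib inner_diff_right)

lemma qform_matrix_sum: "qform (\<Sum>e\<in>E. X e) u = (\<Sum>e\<in>E. qform (X e) u)"
  by (induction E rule: infinite_finite_induct) (auto simp: qform_matrix_add, simp_all add: qform_def)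

lemma qform_matrix_scaleR: "qform (c *\<^sub>R X) u = c * qform X u"
  by (simp add: qform_def scaleR_matrix_vector_assoc[symmetric])

lemma qform_feedback_term:
  assumes sym: "transpose P = P"
  shows "qform (transpose X ** P ** B ** W ** transpose B ** P ** X) u
       = qform W (transpose B *v (P *v (X *v u)))"
proof -
  have "transpose X ** P ** B ** W ** transpose B ** P ** X
      = transpose (transpose B ** P ** X) ** W ** (transpose B ** P ** X)"
    by (simp add: matrix_transpose_mul sym matrix_mul_assoc)
  then have "qform (transpose X ** P ** B ** W ** transpose B ** P ** X) u
      = qform W ((transpose B ** P ** X) *v u)"
    by (simp only: qform_transpose_mult)
  then show ?thesis by (simp only: matrix_vector_mul_assoc matrix_mul_assoc)
qed

text \<open>The input \<open>g\<close> enters \<open>qform P (F z + B g)\<close> through \<open>2 g \<bullet> h + qform P (B g)\<close> with \<open>h = B\<^sup>T P F z\<close>. Adding and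
  subtracting \<open>qform S g\<close> gives a concave quadratic in \<open>g\<close> with Hessian weight \<open>S - B\<^sup>T P B\<close>, bounded by the third
  term of the Riccati equation, plus \<open>qform S g\<close>, bounded by its \<open>C\<^sup>T S\<^sup>-\<^sup>1 C\<close> term. The variance terms of the equation
  that carry the weight \<open>W\<close> are nonnegative and are dropped.\<close>

lemma riccati_decrease:
  fixes F P R :: "real^'s^'s" and B :: "real^'r^'s" and C :: "real^'s^'r" and S :: "real^'r^'r"
  assumes P: "pos_def P"
    and W: "pos_def (S - transpose B ** P ** B)"
    and eq: "P = riccati_rhs F B C S EU \<sigma> Ae P R"
    and g: "qform S g \<le> qform (matrix_inv S) (C *v z)"
  shows "qform P (F *v z + B *v g) + (\<Sum>e\<in>EU. (\<sigma> e)\<^sup>2 * qform P (Ae e *v z)) \<le> qform P z - qform R z"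
proof -
  let ?W = "matrix_inv (S - transpose B ** P ** B)"
  let ?h = "transpose B *v (P *v (F *v z))"
  note sym = pos_def_symmetric[OF P]
  have Pz: "qform P z = qform P (F *v z) + (\<Sum>e\<in>EU. (\<sigma> e)\<^sup>2 * qform P (Ae e *v z)) + qform ?W ?h
      + (\<Sum>e\<in>EU. (\<sigma> e)\<^sup>2 * qform ?W (transpose B *v (P *v (Ae e *v z))))
      + qform (matrix_inv S) (C *v z) + qform R z"
    by (subst eq) (simp only: riccati_rhs_def Let_def qform_matrix_add qform_matrix_sum qform_matrix_scaleR
        qform_feedback_term[OF sym] qform_transpose_mult)
  have "0 \<le> (\<Sum>e\<in>EU. (\<sigma> e)\<^sup>2 * qform ?W (transpose B *v (P *v (Ae e *v z))))"
    by (intro sum_nonneg mult_nonneg_nonneg qform_matrix_inv_nonneg[OF W]) simp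
  moreover have "qform P (F *v z + B *v g) = qform P (F *v z) + 2 * (g \<bullet> ?h) + qform P (B *v g)"
    using inner_symmetric_mult[OF sym, of "F *v z" "B *v g"]
    by (simp only: qform_add[OF sym] inner_transpose_mult)
  moreover have "2 * (g \<bullet> ?h) - (qform S g - qform P (B *v g)) \<le> qform ?W ?h"
    using complete_the_square[OF W, of g ?h] by (simp only: qform_matrix_diff qform_transpose_mult)
  ultimately show ?thesis using Pz g by linarith
qed

text \<open>The sector \<open>qform S f \<le> 2 f \<bullet> y\<close> is an ellipsoid in \<open>f\<close> centred at \<open>S\<^sup>-\<^sup>1 y\<close>; measured from its centre it is a
  ball in the norm of \<open>S\<close>, which is the form of bound that \<open>riccati_decrease\<close> takes for its input.\<close>

lemma sector_loop_transform:
  assumes S: "pos_def S" and f: "qform S f \<le> 2 * (f \<bullet> y)"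
  shows "qform S (matrix_inv S *v y - f) \<le> qform (matrix_inv S) y"
proof -
  note cancel = matrix_inv_cancel[OF pos_def_invertible[OF S]]
  have "qform S (matrix_inv S *v y - f) = qform (matrix_inv S) y - 2 * (f \<bullet> y) + qform S f"
    using qform_add[OF pos_def_symmetric[OF S], of "- f" "matrix_inv S *v y"]
    by (simp add: qform_def cancel matrix_vector_mult_uminus inner_commute)
  with f show ?thesis by simp
qed

section \<open>Kronecker products\<close>

lemma sum_prod_univ: "(\<Sum>p\<in>UNIV. f p) = (\<Sum>i\<in>UNIV. \<Sum>a\<in>UNIV. f (i, a))"
  for f :: "'a::finite \<times> 'b::finite \<Rightarrow> real"
  by (simp add: sum.cartesian_product UNIV_Times_UNIV[symmetric] del: UNIV_Times_UNIV)

lemma kron_mult: "kron X Y ** kron X' Y' = kron (X ** X') (Y ** Y')"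
  by (simp add: vec_eq_iff kron_def matrix_matrix_mult_def sum_prod_univ sum_product mult_ac)

lemma transpose_kron: "transpose (kron X Y) = kron (transpose X) (transpose Y)"
  by (simp add: vec_eq_iff kron_def transpose_def)

lemma kron_add_left: "kron (X + X') Y = kron X Y + kron X' Y"
  by (simp add: vec_eq_iff kron_def algebra_simps)

lemma kron_sum_left: "kron (\<Sum>e\<in>E. X e) Y = (\<Sum>e\<in>E. kron (X e) Y)"
  by (simp add: vec_eq_iff kron_def sum_distrib_right)

lemma kron_scaleR_left: "kron (c *\<^sub>R X) Y = c *\<^sub>R kron X Y"
  by (simp add: vec_eq_iff kron_def)

lemma sum_if_const: "(\<Sum>a\<in>E. if b then f a else 0) = (if b then (\<Sum>a\<in>E. f a) else (0::real))"
  by simp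

lemma subsys_blk: "subsys i (blk Y *v u) = Y *v subsys i u"
  by (simp add: vec_eq_iff subsys_def blk_def kron_def matrix_vector_mult_def mat_def sum_prod_univ
      if_distribR if_distrib[of "\<lambda>x. x * _"] sum_if_const sum.delta cong: if_cong)

lemma inner_subsys: "u \<bullet> w = (\<Sum>i\<in>UNIV. subsys i u \<bullet> subsys i w)"
  by (simp add: inner_vec_def subsys_def sum_prod_univ)

section \<open>Moments of random combinations of independent vectors\<close>

lemma borel_measurable_matrix_vector_mult [measurable (raw)]:
  fixes X :: "real^'b^'a"
  assumes "f \<in> borel_measurable H"
  shows "(\<lambda>\<omega>. X *v f \<omega>) \<in> borel_measurable H"
  by (rule borel_measurable_continuous_on[OF _ assms])
     (intro linear_continuous_on matrix_vector_mul_bounded_linear)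

lemma borel_measurable_qform [measurable (raw)]:
  "f \<in> borel_measurable H \<Longrightarrow> (\<lambda>\<omega>. qform P (f \<omega>)) \<in> borel_measurable H"
  unfolding qform_def by (intro borel_measurable_inner borel_measurable_matrix_vector_mult)

lemma integrable_inner_matrix:
  fixes u w :: "'w \<Rightarrow> real^'s"
  assumes [measurable]: "u \<in> borel_measurable M" "w \<in> borel_measurable M"
    and int: "integrable M (\<lambda>\<omega>. (norm (u \<omega>))\<^sup>2)" "integrable M (\<lambda>\<omega>. (norm (w \<omega>))\<^sup>2)"
  shows "integrable M (\<lambda>\<omega>. u \<omega> \<bullet> (P *v w \<omega>))"
proof (rule Bochner_Integration.integrable_bound)
  show "integrable M (\<lambda>\<omega>. mat_norm P * ((norm (u \<omega>))\<^sup>2 + (norm (w \<omega>))\<^sup>2))"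
    using int by auto
  have "\<bar>u \<omega> \<bullet> (P *v w \<omega>)\<bar> \<le> mat_norm P * ((norm (u \<omega>))\<^sup>2 + (norm (w \<omega>))\<^sup>2)" for \<omega>
  proof -
    have "\<bar>u \<omega> \<bullet> (P *v w \<omega>)\<bar> \<le> norm (u \<omega>) * norm (P *v w \<omega>)"
      by (rule Cauchy_Schwarz_ineq2)
    also have "\<dots> \<le> norm (u \<omega>) * (mat_norm P * norm (w \<omega>))"
      unfolding mat_norm_def
      by (intro mult_left_mono onorm matrix_vector_mul_bounded_linear) simp
    also have "\<dots> = mat_norm P * (norm (u \<omega>) * norm (w \<omega>))" by simp
    also have "\<dots> \<le> mat_norm P * ((norm (u \<omega>))\<^sup>2 + (norm (w \<omega>))\<^sup>2)"
    proof (intro mult_left_mono mat_norm_nonneg)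
      have "2 * (norm (u \<omega>) * norm (w \<omega>)) \<le> (norm (u \<omega>))\<^sup>2 + (norm (w \<omega>))\<^sup>2"
        using sum_squares_bound[of "norm (u \<omega>)" "norm (w \<omega>)"] by simp
      then show "norm (u \<omega>) * norm (w \<omega>) \<le> (norm (u \<omega>))\<^sup>2 + (norm (w \<omega>))\<^sup>2"
        using mult_nonneg_nonneg[OF norm_ge_zero norm_ge_zero, of "u \<omega>" "w \<omega>"] by linarith
    qed
    finally show ?thesis .
  qed
  then show "AE \<omega> in M. norm (u \<omega> \<bullet> (P *v w \<omega>)) \<le> norm (mat_norm P * ((norm (u \<omega>))\<^sup>2 + (norm (w \<omega>))\<^sup>2))"
    by (intro AE_I2) (simp add: order.trans[OF _ abs_ge_self])
qed measurable

lemma integrable_norm_sq_matrix_mult: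
  fixes X :: "real^'b^'a" and f :: "'w \<Rightarrow> real^'b"
  assumes [measurable]: "f \<in> borel_measurable M"
    and int: "integrable M (\<lambda>\<omega>. (norm (f \<omega>))\<^sup>2)"
  shows "integrable M (\<lambda>\<omega>. (norm (X *v f \<omega>))\<^sup>2)"
proof -
  have "(norm (X *v f \<omega>))\<^sup>2 = f \<omega> \<bullet> ((transpose X ** X) *v f \<omega>)" for \<omega>
    by (simp only: inner_transpose_mult matrix_vector_mul_assoc[symmetric] power2_norm_eq_inner)
  then show ?thesis using integrable_inner_matrix[OF assms(1,1) int int] by simp
qed

text \<open>Independence is expressed through two \<open>\<sigma>\<close>-algebras \<open>K\<close> and \<open>H\<close>, for the present and for the history, so that each new pair of
  observables needs only measurability.\<close>

lemma (in prob_space) indep_sub_algebras_mult: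
  fixes X Y :: "'a \<Rightarrow> real"
  assumes sp: "space K = space M" "space H = space M"
    and indep: "indep_set (sets K) (sets H)"
    and X: "X \<in> borel_measurable K" "integrable M X"
    and Y: "Y \<in> borel_measurable H" "integrable M Y"
  shows "integrable M (\<lambda>\<omega>. X \<omega> * Y \<omega>)"
    and "expectation (\<lambda>\<omega>. X \<omega> * Y \<omega>) = expectation X * expectation Y"
proof -
  have sub: "sigma_sets (space M) {Z -` A \<inter> space M | A. A \<in> sets borel} \<subseteq> sets L"
    if "Z \<in> borel_measurable L" "space L = space M" for Z :: "'a \<Rightarrow> real" and L
    using that by (intro sets.sigma_sets_subset[of _ L, unfolded that(2)])
      (auto simp flip: that(2) intro: measurable_sets)
  have "indep_var borel X borel Y"
    unfolding indep_var_eq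
  proof (intro conjI)
    show "indep_set (sigma_sets (space M) {X -` A \<inter> space M |A. A \<in> sets borel})
       (sigma_sets (space M) {Y -` A \<inter> space M |A. A \<in> sets borel})"
      using sub[OF X(1) sp(1)] sub[OF Y(1) sp(2)] indep unfolding indep_sets2_eq by blast
  qed (use X Y in auto)
  then show "integrable M (\<lambda>\<omega>. X \<omega> * Y \<omega>)"
    "expectation (\<lambda>\<omega>. X \<omega> * Y \<omega>) = expectation X * expectation Y"
    using X Y by (auto intro: indep_var_integrable indep_var_lebesgue_integral)
qed

lemma matrix_vector_mult_sum: "X *v (\<Sum>e\<in>E. u e) = (\<Sum>e\<in>E. X *v (u e :: real^'b))"
  by (induction E rule: infinite_finite_induct) (auto simp: matrix_vector_right_distrib)

lemma inner_matrix_sum: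
  fixes P :: "real^'s^'s"
  shows "(\<Sum>e\<in>E. c e *\<^sub>R b e) \<bullet> (P *v (\<Sum>e\<in>E. c e *\<^sub>R b e))
     = (\<Sum>e\<in>E. \<Sum>d\<in>E. c e * c d * (b e \<bullet> (P *v b d)))"
proof -
  have lin: "P *v (\<Sum>e\<in>E. c e *\<^sub>R b e) = (\<Sum>e\<in>E. c e *\<^sub>R (P *v b e))"
    by (simp add: matrix_vector_mult_sum matrix_vector_mult_scaleR)
  show ?thesis
    unfolding lin by (subst sum.swap) (simp add: inner_sum_left inner_sum_right mult_ac sum_distrib_left)
qed

lemma qform_random_combination:
  assumes "transpose P = P"
  shows "qform P (a + (\<Sum>e\<in>E. c e *\<^sub>R b e)) = qform P a + (\<Sum>e\<in>E. c e * (2 * (a \<bullet> (P *v b e))))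
     + (\<Sum>e\<in>E. \<Sum>d\<in>E. c e * c d * (b e \<bullet> (P *v b d)))"
  unfolding qform_add[OF assms] unfolding qform_def inner_matrix_sum
  by (simp add: matrix_vector_mult_sum matrix_vector_mult_scaleR inner_sum_right
      sum_distrib_left mult_ac)

text \<open>In the expansion of the quadratic form every factor built from \<open>\<zeta>\<close> is independent of the factor built from \<open>a\<close>
  and \<open>b\<close>. The linear terms vanish by \<open>E \<zeta>\<^sub>e = 0\<close> and the mixed quadratic ones by uncorrelatedness, so only the diagonal
  terms remain.\<close>

lemma (in prob_space) expectation_qform_random_combination:
  fixes a :: "'a \<Rightarrow> real^'s" and b :: "'e \<Rightarrow> 'a \<Rightarrow> real^'s" and \<zeta> :: "'e \<Rightarrow> 'a \<Rightarrow> real"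
  assumes sym: "transpose P = P" and fin: "finite E"
    and sp: "space K = space M" "space H = space M"
    and indep: "indep_set (sets K) (sets H)"
    and \<zeta>: "\<And>e. e \<in> E \<Longrightarrow> \<zeta> e \<in> borel_measurable K"
    and mean: "\<And>e. e \<in> E \<Longrightarrow> integrable M (\<zeta> e)" "\<And>e. e \<in> E \<Longrightarrow> expectation (\<zeta> e) = 0"
    and cov: "\<And>e d. e \<in> E \<Longrightarrow> d \<in> E \<Longrightarrow> integrable M (\<lambda>\<omega>. \<zeta> e \<omega> * \<zeta> d \<omega>)"
      "\<And>e d. e \<in> E \<Longrightarrow> d \<in> E \<Longrightarrow> expectation (\<lambda>\<omega>. \<zeta> e \<omega> * \<zeta> d \<omega>) = (if e = d then (\<sigma> e)\<^sup>2 else 0)"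
    and a: "a \<in> borel_measurable H" "integrable M (\<lambda>\<omega>. (norm (a \<omega>))\<^sup>2)"
    and b: "\<And>e. e \<in> E \<Longrightarrow> b e \<in> borel_measurable H"
      "\<And>e. e \<in> E \<Longrightarrow> integrable M (\<lambda>\<omega>. (norm (b e \<omega>))\<^sup>2)"
  shows "integrable M (\<lambda>\<omega>. qform P (a \<omega> + (\<Sum>e\<in>E. \<zeta> e \<omega> *\<^sub>R b e \<omega>)))" (is ?int)
    and "expectation (\<lambda>\<omega>. qform P (a \<omega> + (\<Sum>e\<in>E. \<zeta> e \<omega> *\<^sub>R b e \<omega>)))
      = expectation (\<lambda>\<omega>. qform P (a \<omega>)) + (\<Sum>e\<in>E. (\<sigma> e)\<^sup>2 * expectation (\<lambda>\<omega>. qform P (b e \<omega>)))" (is ?eq)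
proof -
  have "subalgebra M H"
    using indep sp(2) indep_setD_ev2 by (auto simp: subalgebra_def)
  note HM = measurable_from_subalg[OF this]
  have cross: "integrable M (\<lambda>\<omega>. u \<omega> \<bullet> (P *v w \<omega>))" "(\<lambda>\<omega>. u \<omega> \<bullet> (P *v w \<omega>)) \<in> borel_measurable H"
    if "u \<in> borel_measurable H" "integrable M (\<lambda>\<omega>. (norm (u \<omega>))\<^sup>2)"
      "w \<in> borel_measurable H" "integrable M (\<lambda>\<omega>. (norm (w \<omega>))\<^sup>2)" for u w :: "'a \<Rightarrow> real^'s"
    using that by (auto intro!: integrable_inner_matrix HM borel_measurable_inner borel_measurable_matrix_vector_mult)
  have qa: "integrable M (\<lambda>\<omega>. qform P (a \<omega>))"
    unfolding qform_def by (rule cross(1)[OF a a])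
  have lin: "integrable M (\<lambda>\<omega>. \<zeta> e \<omega> * (2 * (a \<omega> \<bullet> (P *v b e \<omega>))))"
    "expectation (\<lambda>\<omega>. \<zeta> e \<omega> * (2 * (a \<omega> \<bullet> (P *v b e \<omega>)))) = 0" if "e \<in> E" for e
    using indep_sub_algebras_mult[OF sp indep \<zeta>[OF that] mean(1)[OF that],
        of "\<lambda>\<omega>. 2 * (a \<omega> \<bullet> (P *v b e \<omega>))"] cross[OF a b(1)[OF that] b(2)[OF that]] mean(2)[OF that]
    by auto
  have quad: "integrable M (\<lambda>\<omega>. \<zeta> e \<omega> * \<zeta> d \<omega> * (b e \<omega> \<bullet> (P *v b d \<omega>)))"
    "expectation (\<lambda>\<omega>. \<zeta> e \<omega> * \<zeta> d \<omega> * (b e \<omega> \<bullet> (P *v b d \<omega>)))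
      = (if e = d then (\<sigma> e)\<^sup>2 * expectation (\<lambda>\<omega>. qform P (b e \<omega>)) else 0)" if "e \<in> E" "d \<in> E" for e d
    using indep_sub_algebras_mult[OF sp indep borel_measurable_times[OF \<zeta>[OF that(1)] \<zeta>[OF that(2)]] cov(1)[OF that],
        of "\<lambda>\<omega>. b e \<omega> \<bullet> (P *v b d \<omega>)"] cross[OF b(1)[OF that(1)] b(2)[OF that(1)] b(1)[OF that(2)] b(2)[OF that(2)]]
      cov(2)[OF that]
    by (auto simp: qform_def)
  show ?int
    unfolding qform_random_combination[OF sym]
    by (intro Bochner_Integration.integrable_add Bochner_Integration.integrable_sum qa lin quad)
  have "expectation (\<lambda>\<omega>. qform P (a \<omega> + (\<Sum>e\<in>E. \<zeta> e \<omega> *\<^sub>R b e \<omega>)))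
     = expectation (\<lambda>\<omega>. qform P (a \<omega>))
       + (\<Sum>e\<in>E. expectation (\<lambda>\<omega>. \<zeta> e \<omega> * (2 * (a \<omega> \<bullet> (P *v b e \<omega>)))))
       + (\<Sum>e\<in>E. \<Sum>d\<in>E. expectation (\<lambda>\<omega>. \<zeta> e \<omega> * \<zeta> d \<omega> * (b e \<omega> \<bullet> (P *v b d \<omega>))))"
    unfolding qform_random_combination[OF sym]
    by (simp add: Bochner_Integration.integral_add Bochner_Integration.integral_sum Bochner_Integration.integrable_add
        Bochner_Integration.integrable_sum qa lin(1) quad(1))
  also have "\<dots> = expectation (\<lambda>\<omega>. qform P (a \<omega>)) + (\<Sum>e\<in>E. (\<sigma> e)\<^sup>2 * expectation (\<lambda>\<omega>. qform P (b e \<omega>)))"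
    using fin by (simp add: lin(2) quad(2))
  finally show ?eq .
qed

section \<open>Independence of the current link weights and the history\<close>

text \<open>The additive noise as one \<open>\<sigma>\<close>-algebra and the single link variables form one independent family, here indexed by
  options with \<^const>\<open>None\<close> for the additive noise. Two disjoint groups of an independent family generate
  independent \<open>\<sigma>\<close>-algebras: \<open>K\<close> from the link variables at time \<open>t\<close>, \<open>H\<close> from the earlier ones together with the
  additive noise. The whole additive noise
  process may go into \<open>H\<close>, also its values at and after time \<open>t\<close>.\<close>

lemma (in prob_space) link_noise_indep_history:
  fixes \<xi> :: "'e \<Rightarrow> nat \<Rightarrow> 'a \<Rightarrow> real" and v :: "nat \<Rightarrow> 'a \<Rightarrow> real^'s"
  assumes links: "link_noise M EU \<sigma> \<xi>" and indep: "noises_independent M EU \<xi> v"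
  obtains K H where "space K = space M" "space H = space M" "indep_set (sets K) (sets H)"
    "\<And>e. e \<in> EU \<Longrightarrow> \<xi> e t \<in> borel_measurable K"
    "\<And>e s. e \<in> EU \<Longrightarrow> s < t \<Longrightarrow> \<xi> e s \<in> borel_measurable H"
    "\<And>s. v s \<in> borel_measurable H"
proof -
  define W where "W = vimage_algebra (space M) (\<lambda>\<omega>. \<lambda>p\<in>EU \<times> UNIV. \<xi> (fst p) (snd p) \<omega>)
    (PiM (EU \<times> UNIV) (\<lambda>_. borel :: real measure))"
  define V where "V = vimage_algebra (space M) (\<lambda>\<omega> t. v t \<omega>) (PiM UNIV (\<lambda>_. borel :: (real^'s) measure))"
  have WV: "indep_set (sets W) (sets V)"
    using indep by (simp add: noises_independent_def W_def V_def)
  have spW: "space W = space M" and spV: "space V = space M" by (simp_all add: W_def V_def)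
  have \<xi>W: "\<xi> (fst p) (snd p) \<in> borel_measurable W" if "p \<in> EU \<times> UNIV" for p
  proof -
    have "(\<lambda>\<omega>. \<lambda>p\<in>EU \<times> UNIV. \<xi> (fst p) (snd p) \<omega>) \<in> measurable W (PiM (EU \<times> UNIV) (\<lambda>_. borel))"
      unfolding W_def by (intro measurable_vimage_algebra1) (auto simp: space_PiM)
    from measurable_compose[OF this measurable_component_singleton[OF that]] that show ?thesis by simp
  qed
  have vV: "v s \<in> borel_measurable V" for s
  proof -
    have "(\<lambda>\<omega> t. v t \<omega>) \<in> measurable V (PiM UNIV (\<lambda>_. borel))"
      unfolding V_def by (intro measurable_vimage_algebra1) (auto simp: space_PiM)
    from measurable_compose[OF this measurable_component_singleton[of s]] show ?thesis by simp
  qed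

  define E where "E = (\<lambda>i. case i of None \<Rightarrow> sets V
    | Some p \<Rightarrow> {\<xi> (fst p) (snd p) -` A \<inter> space M | A. A \<in> sets (borel :: real measure)})"
  have \<xi>E: "indep_sets (\<lambda>p. E (Some p)) (EU \<times> UNIV)"
    using links by (simp add: link_noise_def indep_vars_def2 E_def)
  have EW: "E (Some p) \<subseteq> sets W" if "p \<in> EU \<times> UNIV" for p
    using measurable_sets[OF \<xi>W[OF that]] by (auto simp: E_def spW)
  have ESp: "X \<subseteq> space M" if "X \<in> E i" for X i
    using that sets.sets_into_space[of X V] by (auto simp: E_def spV split: option.splits)
  have ind: "indep_sets E (insert None (Some ` (EU \<times> UNIV)))"
  proof (rule indep_setsI)
    fix i assume "i \<in> insert None (Some ` (EU \<times> (UNIV :: nat set)))"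
    then show "E i \<subseteq> events"
    proof
      assume "i = None" then show ?thesis using indep_setD_ev2[OF WV] by (simp add: E_def)
    next
      assume "i \<in> Some ` (EU \<times> (UNIV :: nat set))"
      then show ?thesis using EW indep_setD_ev1[OF WV] by blast
    qed
  next
    fix A J assume J: "J \<noteq> {}" "J \<subseteq> insert None (Some ` (EU \<times> (UNIV :: nat set)))" "finite J"
      and A: "\<forall>j\<in>J. A j \<in> E j"
    define J' where "J' = Some -` J"
    define X where "X = space M \<inter> (\<Inter>p\<in>J'. A (Some p))"
    have finJ': "finite J'" unfolding J'_def by (rule finite_vimageI[OF J(3)]) simp
    have J': "J' \<subseteq> EU \<times> UNIV" using J(2) by (auto simp: J'_def)
    have AJ': "A (Some p) \<in> E (Some p)" if "p \<in> J'" for p using A that by (auto simp: J'_def)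
    \<comment> \<open>Intersecting with the whole space lets the case of no link event, an empty intersection, take the same route.\<close>
    have XW: "X \<in> sets W"
    proof (cases "J' = {}")
      case False
      then have "X = (\<Inter>p\<in>J'. A (Some p))" using ESp[OF AJ'] by (auto simp: X_def)
      moreover have "A (Some p) \<in> sets W" if "p \<in> J'" for p
        using EW[of p] AJ'[OF that] J' that by blast
      ultimately show ?thesis using False finJ' by (auto intro!: sets.finite_INT)
    qed (simp add: X_def flip: spW)
    have pX: "prob X = (\<Prod>p\<in>J'. prob (A (Some p)))"
    proof (cases "J' = {}")
      case False
      then have "X = (\<Inter>p\<in>J'. A (Some p))" using ESp[OF AJ'] by (auto simp: X_def)
      with indep_setsD[OF \<xi>E J' False finJ', of "\<lambda>p. A (Some p)"] AJ' show ?thesis by simp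
    qed (simp add: X_def prob_space)
    show "prob (\<Inter>j\<in>J. A j) = (\<Prod>j\<in>J. prob (A j))"
    proof (cases "None \<in> J")
      case True
      then have Jeq: "J = insert None (Some ` J')"
        by (auto simp: J'_def)
      have AN: "A None \<in> sets V" using A True by (auto simp: E_def)
      have "(\<Inter>j\<in>J. A j) = X \<inter> A None"
        unfolding Jeq X_def using sets.sets_into_space[OF AN] by (auto simp: spV)
      then have "prob (\<Inter>j\<in>J. A j) = prob X * prob (A None)"
        using indep_setD[OF WV XW AN] by simp
      also have "\<dots> = (\<Prod>j\<in>J. prob (A j))"
        unfolding pX Jeq using finJ' by (subst prod.insert) (auto simp: prod.reindex)
      finally show ?thesis .
    next
      case False
      have "x \<in> J \<longleftrightarrow> x \<in> Some ` J'" for x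
        using False by (cases x) (auto simp: J'_def)
      then have Jeq: "J = Some ` J'" by blast
      then have "J' \<noteq> {}" using J(1) by auto
      then have "(\<Inter>j\<in>J. A j) = X" unfolding Jeq X_def using ESp[OF AJ'] by auto
      then have "prob (\<Inter>j\<in>J. A j) = (\<Prod>p\<in>J'. prob (A (Some p)))" by (simp only: pX)
      then show ?thesis unfolding Jeq by (simp add: prod.reindex)
    qed
  qed

  define I where "I = (\<lambda>b. if b then Some ` (EU \<times> {t}) else insert None (Some ` (EU \<times> {..<t})))"
  have "indep_sets (\<lambda>b. sigma_sets (space M) (\<Union>i\<in>I b. E i)) UNIV"
  proof (rule indep_sets_collect_sigma)
    show "indep_sets E (\<Union>b\<in>UNIV. I b)"
      by (rule indep_sets_mono_index[OF _ ind]) (auto simp: I_def UNIV_bool)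
    show "disjoint_family I" by (auto simp: disjoint_family_on_def I_def)
    show "Int_stable (E i)" for i
    proof (cases i)
      case None then show ?thesis by (auto simp: E_def Int_stable_def)
    next
      case (Some p)
      show ?thesis unfolding Int_stable_def
      proof (intro ballI)
        fix X Y assume "X \<in> E i" "Y \<in> E i"
        then obtain A B where AB: "A \<in> sets borel" "B \<in> sets borel"
          "X = \<xi> (fst p) (snd p) -` A \<inter> space M" "Y = \<xi> (fst p) (snd p) -` B \<inter> space M"
          unfolding Some E_def by auto
        then have "X \<inter> Y = \<xi> (fst p) (snd p) -` (A \<inter> B) \<inter> space M" by auto
        then show "X \<inter> Y \<in> E i"
          unfolding Some E_def using sets.Int[OF AB(1,2)] by (simp only: option.case) blast
      qed
    qed
  qed
  moreover define L where "L = (\<lambda>b. sigma (space M) (\<Union>i\<in>I b. E i))"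
  have Pow: "(\<Union>i\<in>I b. E i) \<subseteq> Pow (space M)" for b using ESp by auto
  have setsL: "sets (L b) = sigma_sets (space M) (\<Union>i\<in>I b. E i)" and spL: "space (L b) = space M" for b
    unfolding L_def using Pow by (auto simp: sets_measure_of space_measure_of)
  ultimately have "indep_sets (case_bool (sets (L True)) (sets (L False))) UNIV"
    by (rule_tac indep_sets_mono_sets) (auto simp: setsL split: bool.splits)
  then have "indep_set (sets (L True)) (sets (L False))" by (simp add: indep_set_def)
  moreover have *: "\<xi> e s \<in> borel_measurable (L b)" if "Some (e, s) \<in> I b" for e s b
  proof (rule measurableI)
    fix A :: "real set" assume "A \<in> sets borel"
    then have "\<xi> e s -` A \<inter> space M \<in> E (Some (e, s))" by (auto simp: E_def)
    with that show "\<xi> e s -` A \<inter> space (L b) \<in> sets (L b)"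
      unfolding setsL spL by (intro sigma_sets.Basic) blast
  qed simp
  moreover have "v s \<in> borel_measurable (L False)" for s
  proof (rule measurableI)
    fix A :: "(real^'s) set" assume "A \<in> sets borel"
    then have "v s -` A \<inter> space M \<in> E None" using measurable_sets[OF vV] by (simp add: E_def spV)
    then show "v s -` A \<inter> space (L False) \<in> sets (L False)"
      unfolding setsL spL by (intro sigma_sets.Basic) (auto simp: I_def)
  qed simp
  ultimately show ?thesis
    using spL by (intro that[of "L True" "L False"]) (auto simp: I_def)
qed

lemma (in prob_space) link_noise_moments:
  assumes links: "link_noise M EU \<sigma> \<xi>" and e: "e \<in> EU"
  shows "integrable M (\<xi> e t)" and "expectation (\<xi> e t) = 0"
    and "d \<in> EU \<Longrightarrow> integrable M (\<lambda>\<omega>. \<xi> e t \<omega> * \<xi> d t \<omega>)"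
    and "d \<in> EU \<Longrightarrow> expectation (\<lambda>\<omega>. \<xi> e t \<omega> * \<xi> d t \<omega>) = (if e = d then (\<sigma> e)\<^sup>2 else 0)"
proof -
  have iv: "indep_vars (\<lambda>_. borel) (\<lambda>p. \<xi> (fst p) (snd p)) (EU \<times> UNIV)"
    using links by (simp add: link_noise_def)
  have meas: "\<xi> d t \<in> borel_measurable M" if "d \<in> EU" for d
    using iv that unfolding indep_vars_def2 by auto
  have int: "integrable M (\<xi> d t)" and mean: "expectation (\<xi> d t) = 0" if "d \<in> EU" for d
    using links that square_integrable_imp_integrable[OF meas[OF that]] by (simp_all add: link_noise_def)
  show "integrable M (\<xi> e t)" "expectation (\<xi> e t) = 0" using int mean e by auto
  assume d: "d \<in> EU"
  have "integrable M (\<lambda>\<omega>. \<xi> e t \<omega> * \<xi> d t \<omega>) \<and>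
    expectation (\<lambda>\<omega>. \<xi> e t \<omega> * \<xi> d t \<omega>) = (if e = d then (\<sigma> e)\<^sup>2 else 0)"
  proof (cases "e = d")
    case True
    have "integrable M (\<lambda>\<omega>. (\<xi> e t \<omega>)\<^sup>2)" "variance (\<xi> e t) = (\<sigma> e)\<^sup>2"
      using links e unfolding link_noise_def by blast+
    with True mean[OF e] show ?thesis by (simp add: power2_eq_square)
  next
    case False
    have iv2: "indep_vars (\<lambda>_. borel) (\<lambda>p. \<xi> (fst p) (snd p)) {(e, t), (d, t)}"
      by (rule indep_vars_subset[OF iv]) (use e d in auto)
    have "integrable M (\<xi> (fst p) (snd p))" if "p \<in> {(e, t), (d, t)}" for p
      using that int[OF e] int[OF d] by auto
    from indep_vars_lebesgue_integral[OF _ iv2 this] indep_vars_integrable[OF _ iv2 this]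
    show ?thesis using mean[OF e] False by simp
  qed
  then show "integrable M (\<lambda>\<omega>. \<xi> e t \<omega> * \<xi> d t \<omega>)"
    "expectation (\<lambda>\<omega>. \<xi> e t \<omega> * \<xi> d t \<omega>) = (if e = d then (\<sigma> e)\<^sup>2 else 0)" by auto
qed

text \<open>The second moment is the trace of the covariance, and each diagonal entry is at most the induced norm.\<close>

lemma (in prob_space) additive_noise_second_moment:
  fixes v :: "nat \<Rightarrow> 'a \<Rightarrow> real^'s"
  assumes "additive_noise M R v"
  shows "expectation (\<lambda>\<omega>. (norm (v t \<omega>))\<^sup>2) \<le> real CARD('s) * mat_norm R"
proof -
  have m: "v t \<in> borel_measurable M" and int: "integrable M (\<lambda>\<omega>. (norm (v t \<omega>))\<^sup>2)"
    and R: "\<And>i. expectation (\<lambda>\<omega>. v t \<omega> $ i * v t \<omega> $ i) = R $ i $ i"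
    using assms by (auto simp: additive_noise_def)
  have "integrable M (\<lambda>\<omega>. v t \<omega> $ i * v t \<omega> $ i)" for i
  proof (rule Bochner_Integration.integrable_bound[OF int])
    show "(\<lambda>\<omega>. v t \<omega> $ i * v t \<omega> $ i) \<in> borel_measurable M"
      using measurable_compose[OF m borel_measurable_nth[of i]] by simp
    show "AE \<omega> in M. norm (v t \<omega> $ i * v t \<omega> $ i) \<le> norm ((norm (v t \<omega>))\<^sup>2)"
      using power_mono[OF component_le_norm_cart abs_ge_zero, of _ i 2]
      by (intro AE_I2) (simp add: power2_eq_square)
  qed
  then have "expectation (\<lambda>\<omega>. (norm (v t \<omega>))\<^sup>2) = (\<Sum>i\<in>UNIV. R $ i $ i)"
    by (simp add: power2_norm_eq_inner inner_vec_def R)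
  also have "\<dots> \<le> (\<Sum>i\<in>(UNIV::'s set). mat_norm R)"
  proof (rule sum_mono)
    fix i :: 's
    have "R $ i $ i = qform R (axis i 1)"
      by (simp add: qform_def inner_axis' matrix_vector_mul_component inner_axis)
    also have "\<dots> \<le> mat_norm R * (norm (axis i (1::real)))\<^sup>2" by (rule qform_upper)
    finally show "R $ i $ i \<le> mat_norm R" by simp
  qed
  finally show ?thesis by simp
qed

section \<open>Projection onto the disagreement space\<close>

definition disagreement :: "real^'q^'N \<Rightarrow> real^('N::finite \<times> 'k::finite)^('q::finite \<times> 'k)" where
  "disagreement U = kron (transpose U) (mat 1)"

lemma disagreement_blk:
  "disagreement U *v (blk Y *v x) = blk Y *v (disagreement U *v x)"
  by (simp only: matrix_vector_mul_assoc disagreement_def blk_def kron_mult matrix_mul_lid matrix_mul_rid)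

lemma disagreement_kron:
  assumes "L ** (U ** transpose U) = L"
  shows "disagreement U *v (kron L Y *v x) = kron (transpose U ** L ** U) Y *v (disagreement U *v x)"
  by (simp only: matrix_vector_mul_assoc disagreement_def kron_mult matrix_mul_lid matrix_mul_rid
      matrix_mul_assoc[symmetric] assms)

text \<open>The columns of \<open>[\<one>/sqrt N  U]\<close> are an orthonormal basis, so \<open>U U\<^sup>T\<close> is the projection onto the complement of \<open>\<one>\<close>.\<close>

lemma diagonalizing_gram:
  fixes U :: "real^'q^'N"
  assumes "diagonalized_by L U"
  shows "(U ** transpose U) $ i $ j = (if i = j then 1 else 0) - 1 / real CARD('N)"
proof -
  have "(bordered U ** transpose (bordered U)) $ i $ j = (if i = j then 1 else 0)"
    using assms by (simp add: diagonalized_by_def mat_def)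
  then show ?thesis
    by (simp add: matrix_matrix_mult_def transpose_def bordered_def UNIV_option_conv sum.reindex)
qed

text \<open>A matrix that annihilates \<open>\<one>\<close> does not notice the projection along \<open>\<one>\<close>. This is what makes the disagreement
  dynamics autonomous: \<open>U\<^sup>T L x\<close> depends on \<open>x\<close> only through \<open>U\<^sup>T x\<close>.\<close>

lemma zero_row_sums_gram:
  fixes U :: "real^'q^'N" and L :: "real^'N^'N"
  assumes diag: "diagonalized_by L0 U" and rows: "\<And>i. (\<Sum>k\<in>UNIV. L $ i $ k) = 0"
  shows "L ** (U ** transpose U) = L"
proof -
  have "(L ** (U ** transpose U)) $ i $ j = L $ i $ j" for i j
  proof -
    have "(L ** (U ** transpose U)) $ i $ j
        = (\<Sum>k\<in>UNIV. L $ i $ k * ((if k = j then 1 else 0) - 1 / real CARD('N)))"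
      by (simp only: matrix_matrix_mult_def[of L] vec_lambda_beta diagonalizing_gram[OF diag])
    also have "\<dots> = (\<Sum>k\<in>UNIV. (if k = j then L $ i $ k else 0) - L $ i $ k / real CARD('N))"
      by (intro sum.cong) (auto simp: right_diff_distrib)
    also have "\<dots> = L $ i $ j - (\<Sum>k\<in>UNIV. L $ i $ k) / real CARD('N)"
      by (simp add: sum_subtractf sum_divide_distrib)
    finally show ?thesis by (simp add: rows)
  qed
  then show ?thesis by (simp add: vec_eq_iff)
qed

lemma laplacian_row_sum: "(\<Sum>k\<in>UNIV. laplacian \<mu> $ i $ k) = 0"
proof -
  have "(\<Sum>k\<in>UNIV. laplacian \<mu> $ i $ k)
      = laplacian \<mu> $ i $ i + (\<Sum>k\<in>UNIV - {i}. laplacian \<mu> $ i $ k)"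
    by (rule sum.remove) auto
  also have "(\<Sum>k\<in>UNIV - {i}. laplacian \<mu> $ i $ k) = (\<Sum>k\<in>UNIV - {i}. - \<mu> i k)"
    by (intro sum.cong) (auto simp: laplacian_def)
  finally show ?thesis by (simp add: laplacian_def sum_negf)
qed

text \<open>For a loop the definition gives the unit vector, not zero; hence the hypothesis.\<close>

lemma link_vec_sum:
  assumes "fst e \<noteq> snd e"
  shows "(\<Sum>k\<in>UNIV. link_vec e $ k) = 0"
proof -
  have "link_vec e $ k = (if k = fst e then 1 else 0) - (if k = snd e then 1 else 0)" for k
    using assms by (simp add: link_vec_def)
  then show ?thesis by (simp add: sum_subtractf)
qed

lemma random_laplacian_row_sum:
  assumes "\<And>e. e \<in> EU \<Longrightarrow> fst e \<noteq> snd e"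
  shows "(\<Sum>k\<in>UNIV. random_laplacian \<mu> EU \<Xi> $ i $ k) = 0"
proof -
  have "(\<Sum>k\<in>UNIV. random_laplacian \<mu> EU \<Xi> $ i $ k)
      = (\<Sum>k\<in>UNIV. laplacian \<mu> $ i $ k)
        + (\<Sum>e\<in>EU. \<Xi> e * (link_vec e $ i * (\<Sum>k\<in>UNIV. link_vec e $ k)))"
    by (simp add: random_laplacian_def outer_def sum.distrib sum_distrib_left sum.swap[of _ UNIV EU])
  then show ?thesis using assms by (simp add: laplacian_row_sum link_vec_sum)
qed

lemma transpose_outer_mult: "transpose U ** outer u ** U = outer (transpose U *v u)"
proof -
  have "(transpose U ** outer u ** U) $ i $ j = outer (transpose U *v u) $ i $ j" for i j
    unfolding outer_def vec_lambda_beta matrix_vector_mult_def sum_product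
    by (subst sum.swap)
       (simp add: matrix_matrix_mult_def transpose_def sum_distrib_right sum_distrib_left mult_ac)
  then show ?thesis by (simp only: vec_eq_iff) simp
qed

lemma matrix_matrix_mult_add_rdistrib: "(X + Y) ** Z = X ** Z + Y ** (Z :: real^'a^'b)"
  by (simp add: vec_eq_iff matrix_matrix_mult_def distrib_right sum.distrib)

lemma matrix_sum_rdistrib: "(\<Sum>e\<in>E. X e) *v u = (\<Sum>e\<in>E. X e *v (u :: real^'b))"
  by (induction E rule: infinite_finite_induct) (auto simp: matrix_vector_mult_add_rdistrib)

lemma matrix_conj_sum: "Y ** (\<Sum>e\<in>E. c e *\<^sub>R X e) ** Z = (\<Sum>e\<in>E. c e *\<^sub>R (Y ** X e ** (Z :: real^'a^'b)))"
proof -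
  have "(Y ** (\<Sum>e\<in>E. c e *\<^sub>R X e) ** Z) *v u = (\<Sum>e\<in>E. c e *\<^sub>R (Y ** X e ** Z)) *v u" for u
    by (simp add: matrix_sum_rdistrib matrix_vector_mult_sum matrix_vector_mult_scaleR
        scaleR_matrix_vector_assoc[symmetric] flip: matrix_vector_mul_assoc)
  then show ?thesis by (simp add: matrix_eq)
qed

lemma disagreement_random_laplacian:
  assumes diag: "diagonalized_by L0 U" and loops: "\<And>e. e \<in> EU \<Longrightarrow> fst e \<noteq> snd e"
  shows "disagreement U *v (kron (random_laplacian \<mu> EU \<Xi>) Y *v x)
     = kron (transpose U ** laplacian \<mu> ** U) Y *v (disagreement U *v x)
       + (\<Sum>e\<in>EU. \<Xi> e *\<^sub>R (kron (outer (transpose U *v link_vec e)) Y *v (disagreement U *v x)))"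
proof -
  have "transpose U ** random_laplacian \<mu> EU \<Xi> ** U
      = transpose U ** laplacian \<mu> ** U + (\<Sum>e\<in>EU. \<Xi> e *\<^sub>R outer (transpose U *v link_vec e))"
    by (simp only: random_laplacian_def matrix_add_ldistrib matrix_matrix_mult_add_rdistrib matrix_conj_sum transpose_outer_mult)
  moreover have "random_laplacian \<mu> EU \<Xi> ** (U ** transpose U) = random_laplacian \<mu> EU \<Xi>"
    by (intro zero_row_sums_gram[OF diag] random_laplacian_row_sum loops)
  ultimately show ?thesis
    by (simp only: disagreement_kron kron_add_left kron_sum_left kron_scaleR_left matrix_vector_mult_add_rdistrib
        matrix_sum_rdistrib scaleR_matrix_vector_assoc)
qed

text \<open>Both sides equal \<open>2 N\<close> times the inner product of the deviations of \<open>u\<close> and \<open>w\<close> from their averages over the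
  subsystems: \<open>T\<^sup>T T = U U\<^sup>T \<otimes> I\<close> subtracts the average.\<close>

lemma inner_disagreement:
  fixes U :: "real^'q^'N" and u w :: "real^('N \<times> 'k::finite)"
  assumes diag: "diagonalized_by L0 U"
  shows "2 * real CARD('N) * ((disagreement U *v u) \<bullet> (disagreement U *v w))
     = (\<Sum>i\<in>UNIV. \<Sum>j\<in>UNIV. (subsys i u - subsys j u) \<bullet> (subsys i w - subsys j w))"
proof -
  let ?N = "real CARD('N)"
  let ?S = "\<Sum>i\<in>UNIV. subsys i u \<bullet> subsys i w"
  let ?D = "\<Sum>i\<in>UNIV. \<Sum>j\<in>UNIV. subsys i u \<bullet> subsys j w"
  let ?G = "kron (U ** transpose U) (mat 1 :: real^'k^'k)"
  have G: "subsys i (?G *v w) = subsys i w - (1 / ?N) *\<^sub>R (\<Sum>j\<in>UNIV. subsys j w)" for i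
  proof -
    have "(?G *v w) $ (i, a) = w $ (i, a) - (1 / ?N) * (\<Sum>j\<in>UNIV. w $ (j, a))" for a
    proof -
      have "(?G *v w) $ (i, a) = (\<Sum>j\<in>UNIV. \<Sum>c\<in>UNIV. (U ** transpose U) $ i $ j * (if a = c then w $ (j, c) else 0))"
        by (simp add: matrix_vector_mult_def kron_def mat_def sum_prod_univ if_distrib if_distribR mult_ac cong: if_cong)
      also have "\<dots> = (\<Sum>j\<in>UNIV. (U ** transpose U) $ i $ j * w $ (j, a))"
        by (simp add: sum_distrib_left[symmetric])
      also have "\<dots> = (\<Sum>j\<in>UNIV. (if i = j then w $ (j, a) else 0) - w $ (j, a) / ?N)"
        unfolding diagonalizing_gram[OF diag] by (intro sum.cong) (auto simp: left_diff_distrib)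
      also have "\<dots> = w $ (i, a) - (1 / ?N) * (\<Sum>j\<in>UNIV. w $ (j, a))"
        by (simp add: sum_subtractf sum_divide_distrib)
      finally show ?thesis .
    qed
    then show ?thesis by (simp add: vec_eq_iff subsys_def)
  qed
  have "(disagreement U *v u) \<bullet> (disagreement U *v w) = u \<bullet> (?G *v w)"
    unfolding inner_transpose_mult[symmetric]
    by (simp only: matrix_vector_mul_assoc disagreement_def transpose_kron transpose_transpose transpose_mat kron_mult
        matrix_mul_lid)
  also have "\<dots> = ?S - ?D / ?N"
    unfolding inner_subsys[of u] G
    by (simp add: inner_diff_right inner_sum_right sum_subtractf sum_divide_distrib)
  finally have "2 * ?N * ((disagreement U *v u) \<bullet> (disagreement U *v w)) = 2 * (?N * ?S) - 2 * ?D"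
    by (simp add: field_simps)
  also have "\<dots> = (\<Sum>i\<in>UNIV. \<Sum>j\<in>UNIV. (subsys i u - subsys j u) \<bullet> (subsys i w - subsys j w))"
    using sum.swap[of "\<lambda>i j. subsys j u \<bullet> subsys i w" UNIV UNIV]
    by (simp add: inner_diff_left inner_diff_right sum.distrib sum_subtractf sum_distrib_left[symmetric])
  finally show ?thesis .
qed

lemma norm_disagreement:
  fixes U :: "real^'q^'N" and x :: "real^('N \<times> 'k::finite)"
  assumes "diagonalized_by L0 U"
  shows "2 * real CARD('N) * (norm (disagreement U *v x))\<^sup>2 = (\<Sum>i\<in>UNIV. \<Sum>j\<in>UNIV. sq_dist x i j)"
  using inner_disagreement[OF assms, of x x] by (simp add: power2_norm_eq_inner sq_dist_def)

lemma sq_dist_le_disagreement: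
  fixes U :: "real^'q^'N" and x :: "real^('N \<times> 'k::finite)"
  assumes "diagonalized_by L0 U"
  shows "sq_dist x k j \<le> 2 * real CARD('N) * (norm (disagreement U *v x))\<^sup>2"
proof -
  have nn: "0 \<le> sq_dist x a b" for a b by (simp add: sq_dist_def)
  have "sq_dist x k j \<le> (\<Sum>b\<in>UNIV. sq_dist x k b)"
    by (rule member_le_sum[of j]) (auto simp: nn)
  also have "\<dots> \<le> (\<Sum>a\<in>UNIV. \<Sum>b\<in>UNIV. sq_dist x a b)"
    by (rule member_le_sum[of k]) (auto simp: nn sum_nonneg)
  finally show ?thesis by (simp add: norm_disagreement[OF assms])
qed

lemma subsys_stack_map: "subsys i (stack_map f y) = f (subsys i y)"
  by (simp add: subsys_def stack_map_def)

lemma subsys_diff: "subsys i (x - y) = subsys i x - subsys i y"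
  by (simp add: vec_eq_iff subsys_def)

text \<open>The sum of the incremental conditions over all pairs of subsystems, rewritten by \<open>inner_disagreement\<close>. Only the
  symmetric part of \<open>D\<close> survives in the quadratic term.\<close>

lemma disagreement_sector:
  fixes U :: "real^'q^'N" and y :: "real^('N \<times> 'm::finite)"
  assumes diag: "diagonalized_by L0 U" and inc: "incremental_condition D f"
  shows "qform (blk (D + transpose D)) (disagreement U *v stack_map f y)
     \<le> 2 * ((disagreement U *v stack_map f y) \<bullet> (disagreement U *v y))"
proof -
  let ?f = "disagreement U *v stack_map f y"
  have "0 \<le> (\<Sum>i\<in>UNIV. \<Sum>j\<in>UNIV. (f (subsys i y) - f (subsys j y)) \<bullet>
      ((subsys i y - subsys j y) - D *v (f (subsys i y) - f (subsys j y))))"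
    using inc unfolding incremental_condition_def
    by (intro sum_nonneg) (metis diff_self inner_zero_left order.order_iff_strict)
  also have "\<dots> = (\<Sum>i\<in>UNIV. \<Sum>j\<in>UNIV. (subsys i (stack_map f y) - subsys j (stack_map f y)) \<bullet>
      (subsys i (y - blk D *v stack_map f y) - subsys j (y - blk D *v stack_map f y)))"
    by (simp add: subsys_diff subsys_blk subsys_stack_map matrix_vector_mult_diff_distrib algebra_simps)
  also have "\<dots> = 2 * real CARD('N) * (?f \<bullet> (disagreement U *v (y - blk D *v stack_map f y)))"
    by (simp only: inner_disagreement[OF diag])
  finally have "0 \<le> ?f \<bullet> (disagreement U *v (y - blk D *v stack_map f y))"
    by (simp add: zero_le_mult_iff)
  then have "?f \<bullet> (blk D *v ?f) \<le> ?f \<bullet> (disagreement U *v y)"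
    by (simp add: matrix_vector_mult_diff_distrib disagreement_blk inner_diff_right)
  moreover have "?f \<bullet> (blk (D + transpose D) *v ?f) = 2 * (?f \<bullet> (blk D *v ?f))"
  proof -
    have "(blk (D + transpose D) :: real^('q \<times> 'm)^('q \<times> 'm)) = blk D + transpose (blk D)"
      by (simp add: vec_eq_iff blk_def kron_def transpose_def mat_def algebra_simps)
    then show ?thesis
      by (simp only: matrix_vector_mult_add_rdistrib inner_add_right inner_transpose_mult)
         (simp add: inner_commute)
  qed
  ultimately show ?thesis by (simp add: qform_def)
qed

section \<open>Measurability of the state\<close>

lemma continuous_stack_map:
  assumes "continuous_on UNIV f"
  shows "continuous_on UNIV (stack_map f)"
proof -
  have "continuous_on UNIV (subsys i)" for i :: 'b
    unfolding subsys_def by (intro continuous_on_vec_lambda continuous_on_component continuous_on_id)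
  from continuous_on_component[OF continuous_on_compose2[OF assms this]]
  show ?thesis
    unfolding stack_map_def by (intro continuous_on_vec_lambda) simp
qed

text \<open>With the two matrix terms separated, the step is a sum of terms to which linearity of the projection and the
  closure properties of measurable functions apply directly.\<close>

lemma network_state_Suc:
  "network_state A B C G \<phi> \<mu> EU \<xi> v x0 (Suc t) \<omega> =
    (let x = network_state A B C G \<phi> \<mu> EU \<xi> v x0 t \<omega> in
      blk A *v x - kron (random_laplacian \<mu> EU (\<lambda>e. \<xi> e t \<omega>)) (G ** C) *v x
         - blk B *v stack_map (\<lambda>z. \<phi> z t) (blk C *v x) + v t \<omega>)"
  by (simp add: Let_def matrix_vector_mult_diff_rdistrib)

text \<open>Stated for an arbitrary \<open>\<sigma>\<close>-algebra \<open>H\<close> so that it serves both for the whole probability space and for the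
  history up to time \<open>t\<close>.\<close>

lemma network_state_measurable:
  fixes v :: "nat \<Rightarrow> 'w \<Rightarrow> real^('N::finite \<times> 'n::finite)"
  assumes cont: "\<And>t. continuous_on UNIV (\<lambda>y. \<phi> y t)"
    and \<xi>: "\<And>e s. e \<in> EU \<Longrightarrow> s < t \<Longrightarrow> \<xi> e s \<in> borel_measurable H"
    and v: "\<And>s. v s \<in> borel_measurable H"
  shows "network_state A B C G \<phi> \<mu> EU \<xi> v x0 t \<in> borel_measurable H"
  using \<xi>
proof (induction t)
  case 0
  have "network_state A B C G \<phi> \<mu> EU \<xi> v x0 0 = (\<lambda>_. x0)" by (rule ext) simp
  then show ?case by simp
next
  case (Suc t)
  have state: "network_state A B C G \<phi> \<mu> EU \<xi> v x0 t \<in> borel_measurable H"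
    using Suc by simp
  have \<xi>t: "\<And>e. e \<in> EU \<Longrightarrow> \<xi> e t \<in> borel_measurable H" using Suc.prems by simp
  have stack: "stack_map (\<lambda>z. \<phi> z t) \<in> borel_measurable borel"
    by (intro borel_measurable_continuous_onI continuous_stack_map cont)
  show ?case
    unfolding network_state_Suc[abs_def] Let_def random_laplacian_def kron_add_left kron_sum_left kron_scaleR_left
      matrix_vector_mult_add_rdistrib matrix_sum_rdistrib scaleR_matrix_vector_assoc[symmetric]
    by (intro borel_measurable_add borel_measurable_diff borel_measurable_sum borel_measurable_scaleR
        borel_measurable_matrix_vector_mult measurable_compose[OF _ stack] v \<xi>t state)
qed

section \<open>The synchronization bound\<close>

text \<open>The bound on \<open>\<parallel>z\<^sub>0\<parallel>\<^sup>2\<close> involves all initial differences, while only the factor of the pair in question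
  is available on the right-hand side. The sum of inverses makes up for that factor however small it is; \<open>inverse 0 = 0\<close>
  removes the pairs without a difference, absolute values keep the gain positive on arguments that are not squared
  distances, and the gain is \<open>1\<close> at zero.\<close>

definition sync_gain :: "real \<Rightarrow> ('N::finite \<Rightarrow> 'N \<Rightarrow> real) \<Rightarrow> real" where
  "sync_gain c d = 1 + c * (\<Sum>i\<in>UNIV. \<Sum>l\<in>UNIV. \<bar>d i l\<bar>) * (1 + (\<Sum>i\<in>UNIV. \<Sum>l\<in>UNIV. \<bar>inverse (d i l)\<bar>))"

lemma sync_gain_pos: "0 \<le> c \<Longrightarrow> 0 < sync_gain c d"
  unfolding sync_gain_def by (intro add_pos_nonneg mult_nonneg_nonneg add_nonneg_nonneg sum_nonneg) auto

lemma sync_gain_bound: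
  fixes x0 :: "real^('N::finite \<times> 'n::finite)"
  assumes c: "0 \<le> c"
  shows "c * (\<Sum>i\<in>UNIV. \<Sum>l\<in>UNIV. sq_dist x0 i l) \<le> sync_gain c (sq_dist x0) * initial_factor x0 k j"
proof -
  let ?S = "\<Sum>i\<in>UNIV. \<Sum>l\<in>UNIV. sq_dist x0 i l"
  let ?I = "\<Sum>i\<in>UNIV. \<Sum>l\<in>UNIV. \<bar>inverse (sq_dist x0 i l)\<bar>"
  have nn: "0 \<le> sq_dist x0 a b" for a b by (simp add: sq_dist_def)
  have S: "0 \<le> ?S" and I: "0 \<le> ?I" by (auto intro!: sum_nonneg nn)
  have gain: "sync_gain c (sq_dist x0) = 1 + c * ?S * (1 + ?I)"
    by (simp add: sync_gain_def nn)
  consider "sq_dist x0 k j \<noteq> 0" | "sq_dist x0 k j = 0" "\<exists>i l. sq_dist x0 i l \<noteq> 0" | "\<forall>i l. sq_dist x0 i l = 0"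
    by blast
  then show ?thesis
  proof cases
    case 1
    have "inverse (sq_dist x0 k j) \<le> (\<Sum>l\<in>UNIV. \<bar>inverse (sq_dist x0 k l)\<bar>)"
      using member_le_sum[of j UNIV "\<lambda>l. \<bar>inverse (sq_dist x0 k l)\<bar>"] nn by auto
    also have "\<dots> \<le> ?I"
      by (rule member_le_sum[of k UNIV "\<lambda>i. \<Sum>l\<in>UNIV. \<bar>inverse (sq_dist x0 i l)\<bar>"]) (auto intro: sum_nonneg)
    finally have "1 \<le> ?I * sq_dist x0 k j"
      using 1 nn[of k j] by (metis left_inverse mult_right_mono)
    then have "1 \<le> (1 + ?I) * sq_dist x0 k j" using nn[of k j] by (simp add: distrib_right)
    then have "c * ?S * 1 \<le> c * ?S * ((1 + ?I) * sq_dist x0 k j)"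
      using c S by (intro mult_left_mono mult_nonneg_nonneg) auto
    also have "\<dots> \<le> sync_gain c (sq_dist x0) * sq_dist x0 k j"
      unfolding gain mult.assoc[symmetric] using nn[of k j] by (intro mult_right_mono) auto
    finally show ?thesis using 1 by (simp add: initial_factor_def)
  next
    case 2
    have "c * ?S * 1 \<le> c * ?S * (1 + ?I)"
      using c S I by (intro mult_left_mono mult_nonneg_nonneg) auto
    then have "c * ?S \<le> 1 + c * ?S * (1 + ?I)" by simp
    then show ?thesis using 2 by (auto simp: gain initial_factor_def)
  next
    case 3
    then show ?thesis by (simp add: initial_factor_def)
  qed
qed

lemma geometric_recursion_bound:
  fixes m :: "nat \<Rightarrow> real"
  assumes \<beta>: "0 < \<beta>" "\<beta> < 1" and d: "0 \<le> d"
    and step: "\<And>t. m (Suc t) \<le> \<beta> * m t + d"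
  shows "m t \<le> \<beta> ^ t * m 0 + d / (1 - \<beta>)"
proof (induction t)
  case (Suc t)
  have "m (Suc t) \<le> \<beta> * (\<beta> ^ t * m 0 + d / (1 - \<beta>)) + d"
    using step[of t] mult_left_mono[OF Suc, of \<beta>] \<beta> by linarith
  also have "\<dots> = \<beta> ^ Suc t * m 0 + d / (1 - \<beta>)"
    using \<beta> by (simp add: field_simps)
  finally show ?case .
qed (use \<beta> d in simp)

text \<open>The closed loop \<open>(A - \<Lambda>) z - B f\<close> is \<open>F z + B g\<close> with \<open>F = A - B \<Sigma>\<^sup>-\<^sup>1 C - \<Lambda>\<close> and \<open>g = \<Sigma>\<^sup>-\<^sup>1 C z - f\<close>, so the sector
  inequality, the loop transform and \<open>riccati_decrease\<close> chain together.\<close>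

lemma lyapunov_mean_decrease:
  fixes U :: "real^'q^'N" and A :: "real^'n^'n" and B G :: "real^'m^'n" and C :: "real^'n^'m"
    and P R :: "real^('q \<times> 'n)^('q \<times> 'n)" and x :: "real^('N \<times> 'n)"
  assumes diag: "diagonalized_by L0 U" and inc: "incremental_condition D f" and Sig: "\<Sigma>1 = D + transpose D"
    and P: "pos_def P" and W: "pos_def (blk \<Sigma>1 - transpose (blk B) ** P ** blk B)"
    and eq: "P = riccati_rhs ((blk A - blk B ** matrix_inv (blk \<Sigma>1) ** blk C) - \<Lambda>)
              (blk B) (blk C) (blk \<Sigma>1) EU \<sigma> Ae P R"
  shows "qform P ((blk A - \<Lambda>) *v (disagreement U *v x) - blk B *v (disagreement U *v stack_map f (blk C *v x)))
      + (\<Sum>e\<in>EU. (\<sigma> e)\<^sup>2 * qform P (Ae e *v (disagreement U *v x)))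
    \<le> qform P (disagreement U *v x) - qform R (disagreement U *v x)"
proof -
  let ?z = "disagreement U *v x"
  let ?f = "disagreement U *v stack_map f (blk C *v x)"
  let ?S = "blk \<Sigma>1 :: real^('q \<times> 'm)^('q \<times> 'm)"
  let ?g = "matrix_inv ?S *v (blk C *v ?z) - ?f"
  \<comment> \<open>Positive definiteness of the block matrix follows from that of the Schur-type matrix in W, to which the
      nonnegative form of P at B u is added.\<close>
  have "transpose ?S = ?S"
  proof -
    have "transpose ?S - transpose (transpose (blk B) ** P ** blk B) = ?S - transpose (blk B) ** P ** blk B"
      using pos_def_symmetric[OF W] by (simp add: vec_eq_iff transpose_def)
    moreover have "transpose (transpose (blk B) ** P ** blk B) = transpose (blk B) ** P ** blk B"
      using pos_def_symmetric[OF P] by (simp add: matrix_transpose_mul matrix_mul_assoc)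
    ultimately show ?thesis by simp
  qed
  moreover have "0 < qform ?S u" if "u \<noteq> 0" for u
    using pos_def_qform_pos[OF W that] pos_def_qform_nonneg[OF P, of "blk B *v u"]
    by (simp only: qform_matrix_diff qform_transpose_mult)
  ultimately have S: "pos_def ?S" by (auto simp: pos_def_def qform_def)
  have "qform ?S ?f \<le> 2 * (?f \<bullet> (blk C *v ?z))"
    using disagreement_sector[OF diag inc, of "blk C *v x"] by (simp add: Sig disagreement_blk)
  then have "qform ?S ?g \<le> qform (matrix_inv ?S) (blk C *v ?z)"
    by (rule sector_loop_transform[OF S])
  note decrease = riccati_decrease[OF P W eq this]
  have "(blk A - \<Lambda>) *v ?z - blk B *v ?f
      = ((blk A - blk B ** matrix_inv ?S ** blk C) - \<Lambda>) *v ?z + blk B *v ?g"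
    by (simp add: matrix_vector_mult_diff_rdistrib matrix_vector_mult_diff_distrib algebra_simps
        flip: matrix_vector_mul_assoc)
  with decrease show ?thesis by simp
qed

text \<open>By equivalence of norms \<open>qform R u\<close> is at least a fixed fraction \<open>r / b\<close> of \<open>qform P u\<close>.\<close>

lemma pos_def_contraction:
  fixes P R :: "real^'a^'a"
  assumes P: "pos_def P" and R: "pos_def R"
  obtains \<beta> where "0 < \<beta>" "\<beta> < 1" "\<And>u. qform P u - qform R u \<le> \<beta> * qform P u"
proof -
  obtain r where r: "r > 0" "\<And>u. r * (norm u)\<^sup>2 \<le> qform R u" by (rule pos_def_qform_lower[OF R]) blast
  \<comment> \<open>The summand with r keeps r / b below 1, so that the factor is positive.\<close>
  define b where "b = mat_norm P + 2 * r"
  have b: "b > 0" "r < b" using r(1) mat_norm_nonneg[of P] by (auto simp: b_def)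
  have "qform P u - qform R u \<le> (1 - r / b) * qform P u" for u
  proof -
    have "qform P u \<le> b * (norm u)\<^sup>2"
      using qform_upper[of P u] r(1) unfolding b_def by (simp add: distrib_right add_increasing2)
    then have "r / b * qform P u \<le> r / b * (b * (norm u)\<^sup>2)"
      using r(1) b by (intro mult_left_mono) auto
    also have "\<dots> = r * (norm u)\<^sup>2" using b by simp
    also have "\<dots> \<le> qform R u" by (rule r(2))
    finally show ?thesis by (simp add: left_diff_distrib)
  qed
  with r(1) b show ?thesis by (intro that[of "1 - r / b"]) (auto simp: field_simps)
qed

lemma norm_matrix_mult_sq:
  fixes X :: "real^'b^'a"
  shows "(norm (X *v u))\<^sup>2 \<le> (onorm ((*v) X))\<^sup>2 * (norm u)\<^sup>2"
  using power_mono[OF onorm[OF matrix_vector_mul_bounded_linear[of X], of u] norm_ge_zero, of 2]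
  by (simp add: power_mult_distrib)

theorem theorem11:
  fixes A :: "real^'n^'n" and B G :: "real^'m^'n" and C :: "real^'n^'m"
    and D D1 \<Sigma>1 :: "real^'m^'m"
    and \<phi> :: "real^'m \<Rightarrow> nat \<Rightarrow> real^'m"
    and \<mu> :: "'N::{finite,linorder} \<Rightarrow> 'N \<Rightarrow> real"
    and EU :: "('N \<times> 'N) set" and \<sigma> :: "'N \<times> 'N \<Rightarrow> real"
    and U :: "real^'q^'N::{finite,linorder}"
    and M :: "'w measure"
    and \<xi> :: "'N \<times> 'N \<Rightarrow> nat \<Rightarrow> 'w \<Rightarrow> real"
    and v :: "nat \<Rightarrow> 'w \<Rightarrow> real^('N::{finite,linorder} \<times> 'n::finite)"
    and Rv :: "real^('N::{finite,linorder} \<times> 'n::finite)^('N::{finite,linorder} \<times> 'n::finite)"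
  assumes lipschitz: "\<And>t. \<exists>l. l-lipschitz_on UNIV (\<lambda>y. \<phi> y t)"
    and C1: "\<And>t. C1_map (\<lambda>y. \<phi> y t)"
    and monotone: "\<And>t. monotone_operator (\<lambda>y. \<phi> y t)"
    and sector: "\<And>t. sector_condition D (\<lambda>y. \<phi> y t)"
    and incremental: "\<And>t. incremental_condition D1 (\<lambda>y. \<phi> y t)"
    and Sigma1: "\<Sigma>1 = D1 + transpose D1" "pos_def \<Sigma>1"
    and undirected: "\<And>i j. \<mu> i j = \<mu> j i"
    and uncertain: "\<And>i j. (i, j) \<in> EU \<Longrightarrow> i > j"
    and dim: "CARD('N) = CARD('q) + 1"
    and diag: "diagonalized_by (laplacian \<mu>) U"
    and prob: "prob_space M"
    and links: "link_noise M EU \<sigma> \<xi>"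
    and noise: "additive_noise M Rv v"
    and indep: "noises_independent M EU \<xi> v"
    and riccati: "\<exists>P :: real^('q::finite \<times> 'n::finite)^('q::finite \<times> 'n::finite).
      pos_def P \<and>
      pos_def (blk \<Sigma>1 - transpose (blk B) ** P ** blk B) \<and>
      (\<exists>R. pos_def R \<and>
        P = riccati_rhs
              ((blk A - blk B ** matrix_inv (blk \<Sigma>1) ** blk C)
                 - kron (transpose U ** laplacian \<mu> ** U) (G ** C))
              (blk B) (blk C) (blk \<Sigma>1) EU \<sigma>
              (\<lambda>e. kron (outer (transpose U *v link_vec e)) (G ** C))
              P R)"
  shows "ms_exp_synchronizing M Rv (network_state A B C G \<phi> \<mu> EU \<xi> v)"
proof -
  interpret prob_space M by (rule prob)
  obtain P R :: "real^('q \<times> 'n)^('q \<times> 'n)" where P: "pos_def P"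
    and W: "pos_def (blk \<Sigma>1 - transpose (blk B) ** P ** blk B)" and R: "pos_def R"
    and eq: "P = riccati_rhs
              ((blk A - blk B ** matrix_inv (blk \<Sigma>1) ** blk C)
                 - kron (transpose U ** laplacian \<mu> ** U) (G ** C))
              (blk B) (blk C) (blk \<Sigma>1) EU \<sigma>
              (\<lambda>e. kron (outer (transpose U *v link_vec e)) (G ** C))
              P R"
    using riccati by blast
  note sym = pos_def_symmetric[OF P]
  obtain p where p: "p > 0" "\<And>u. p * (norm u)\<^sup>2 \<le> qform P u"
    by (rule pos_def_qform_lower[OF P]) blast
  obtain \<beta>0 where \<beta>0: "0 < \<beta>0" "\<beta>0 < 1" "\<And>u. qform P u - qform R u \<le> \<beta>0 * qform P u"
    by (rule pos_def_contraction[OF P R]) blast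
  \<comment> \<open>The midpoint between the noise-free factor and 1; the Young parameter is chosen to reach exactly this value.\<close>
  define \<beta> where "\<beta> = (1 + \<beta>0) / 2"
  define \<epsilon> where "\<epsilon> = (1 - \<beta>0) / (2 * \<beta>0)"
  have \<beta>: "0 < \<beta>" "\<beta> < 1" using \<beta>0 by (auto simp: \<beta>_def)
  have \<epsilon>: "\<epsilon> > 0" "(1 + \<epsilon>) * \<beta>0 = \<beta>"
    using \<beta>0 by (auto simp: \<epsilon>_def \<beta>_def field_simps)

  let ?T = "disagreement U :: real^('N \<times> 'n)^('q \<times> 'n)"
  define \<kappa> where "\<kappa> = mat_norm P * ((onorm ((*v) ?T))\<^sup>2 * real CARD('N \<times> 'n))"
  define X where "X = network_state A B C G \<phi> \<mu> EU \<xi> v"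
  define Ae where "Ae = (\<lambda>e. kron (outer (transpose U *v link_vec e)) (G ** C))"
  define a where "a = (\<lambda>x t. (blk A - kron (transpose U ** laplacian \<mu> ** U) (G ** C)) *v (?T *v x)
    - blk B *v (disagreement U *v stack_map (\<lambda>y. \<phi> y t) (blk C *v x)))"
  define V where "V = (\<lambda>x0 t \<omega>. qform P (?T *v X x0 t \<omega>))"

  have loops: "fst e \<noteq> snd e" if "e \<in> EU" for e
    using uncertain[of "fst e" "snd e"] that by auto
  have fin: "finite EU" by simp
  have cont: "continuous_on UNIV (\<lambda>y. \<phi> y t)" for t
    using lipschitz[of t] lipschitz_on_continuous_on by blast
  have vM: "v s \<in> borel_measurable M" and v2: "integrable M (\<lambda>\<omega>. (norm (v s \<omega>))\<^sup>2)" for s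
    using noise by (auto simp: additive_noise_def)
  have \<kappa>: "0 \<le> \<kappa>" by (simp add: \<kappa>_def mat_norm_nonneg)
  have Rv: "0 \<le> mat_norm Rv" by (rule mat_norm_nonneg)

  have decrease: "qform P (a x t) + (\<Sum>e\<in>EU. (\<sigma> e)\<^sup>2 * qform P (Ae e *v (?T *v x)))
      \<le> \<beta>0 * qform P (?T *v x)" for x t
    using lyapunov_mean_decrease[OF diag incremental Sigma1(1) P W eq, of x t] \<beta>0(3)[of "?T *v x"]
    unfolding a_def Ae_def by linarith

  have dynamics: "?T *v X x0 (Suc t) \<omega>
      = (a (X x0 t \<omega>) t + (\<Sum>e\<in>EU. \<xi> e t \<omega> *\<^sub>R (- (Ae e *v (?T *v X x0 t \<omega>))))) + ?T *v v t \<omega>" for x0 t \<omega>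
    unfolding X_def network_state_Suc Let_def a_def Ae_def
    by (simp add: matrix_vector_right_distrib matrix_vector_mult_diff_distrib matrix_vector_mult_diff_rdistrib
        disagreement_random_laplacian[OF diag loops] disagreement_blk sum_negf)

  have noise_bound: "integrable M (\<lambda>\<omega>. qform P (?T *v v t \<omega>))"
    "expectation (\<lambda>\<omega>. qform P (?T *v v t \<omega>)) \<le> \<kappa> * mat_norm Rv" for t
  proof -
    show int: "integrable M (\<lambda>\<omega>. qform P (?T *v v t \<omega>))"
      unfolding qform_def
      by (intro integrable_inner_matrix borel_measurable_matrix_vector_mult integrable_norm_sq_matrix_mult vM v2)
    have "expectation (\<lambda>\<omega>. qform P (?T *v v t \<omega>))
        \<le> expectation (\<lambda>\<omega>. mat_norm P * (onorm ((*v) ?T))\<^sup>2 * (norm (v t \<omega>))\<^sup>2)"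
    proof (rule integral_mono[OF int])
      show "integrable M (\<lambda>\<omega>. mat_norm P * (onorm ((*v) ?T))\<^sup>2 * (norm (v t \<omega>))\<^sup>2)"
        by (intro integrable_mult_right v2)
      show "qform P (?T *v v t \<omega>) \<le> mat_norm P * (onorm ((*v) ?T))\<^sup>2 * (norm (v t \<omega>))\<^sup>2" for \<omega>
        using qform_upper[of P "?T *v v t \<omega>"]
          mult_left_mono[OF norm_matrix_mult_sq[of ?T "v t \<omega>"] mat_norm_nonneg[of P]]
        by (simp add: mult_ac)
    qed
    also have "\<dots> = mat_norm P * (onorm ((*v) ?T))\<^sup>2 * expectation (\<lambda>\<omega>. (norm (v t \<omega>))\<^sup>2)" by simp
    also have "\<dots> \<le> mat_norm P * (onorm ((*v) ?T))\<^sup>2 * (real CARD('N \<times> 'n) * mat_norm Rv)"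
      by (intro mult_left_mono additive_noise_second_moment[OF noise] mult_nonneg_nonneg mat_norm_nonneg) simp
    finally show "expectation (\<lambda>\<omega>. qform P (?T *v v t \<omega>)) \<le> \<kappa> * mat_norm Rv"
      by (simp add: \<kappa>_def mult_ac)
  qed

  have XM: "X x0 t \<in> borel_measurable M" for x0 t
    unfolding X_def
  proof (rule network_state_measurable[OF cont _ vM])
    show "\<xi> e s \<in> borel_measurable M" if "e \<in> EU" for e s
      using links that unfolding link_noise_def indep_vars_def2 by auto
  qed

  have step: "integrable M (V x0 (Suc t)) \<and> expectation (V x0 (Suc t))
      \<le> \<beta> * expectation (V x0 t) + (1 + 1 / \<epsilon>) * (\<kappa> * mat_norm Rv)"
    if VI: "integrable M (V x0 t)" for x0 t
  proof -
    obtain K H where KH: "space K = space M" "space H = space M" "indep_set (sets K) (sets H)"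
      "\<And>e. e \<in> EU \<Longrightarrow> \<xi> e t \<in> borel_measurable K"
      "\<And>e s. e \<in> EU \<Longrightarrow> s < t \<Longrightarrow> \<xi> e s \<in> borel_measurable H"
      "\<And>s. v s \<in> borel_measurable H"
      by (rule link_noise_indep_history[OF links indep, of t]) blast
    have XH: "X x0 t \<in> borel_measurable H"
      unfolding X_def by (rule network_state_measurable[OF cont KH(5,6)])
    have stack: "stack_map (\<lambda>y. \<phi> y t) \<in> borel_measurable borel"
      by (intro borel_measurable_continuous_onI continuous_stack_map cont)
    have meas: "(\<lambda>\<omega>. a (X x0 t \<omega>) t) \<in> borel_measurable N" if "X x0 t \<in> borel_measurable N" for N
      unfolding a_def
      by (intro borel_measurable_diff borel_measurable_matrix_vector_mult measurable_compose[OF _ stack] that)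
    have sub: "0 \<le> (\<Sum>e\<in>EU. (\<sigma> e)\<^sup>2 * qform P (Ae e *v (?T *v X x0 t \<omega>)))" for \<omega>
      by (intro sum_nonneg mult_nonneg_nonneg pos_def_qform_nonneg[OF P]) simp
    have z2: "integrable M (\<lambda>\<omega>. (norm (?T *v X x0 t \<omega>))\<^sup>2)"
    proof (rule Bochner_Integration.integrable_bound[OF integrable_divide[OF VI, of p]])
      show "AE \<omega> in M. norm ((norm (?T *v X x0 t \<omega>))\<^sup>2) \<le> norm (V x0 t \<omega> / p)"
        using p by (intro AE_I2) (auto simp: V_def field_simps intro: order.trans[OF _ abs_ge_self])
    qed (intro borel_measurable_power measurable_compose[OF _ borel_measurable_norm] borel_measurable_matrix_vector_mult XM)
    \<comment> \<open>The decrease inequality itself bounds the drift, nonlinearity included, by the state.\<close>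
    have a2: "integrable M (\<lambda>\<omega>. (norm (a (X x0 t \<omega>) t))\<^sup>2)"
    proof (rule Bochner_Integration.integrable_bound[OF integrable_divide[OF VI, of p]])
      show "AE \<omega> in M. norm ((norm (a (X x0 t \<omega>) t))\<^sup>2) \<le> norm (V x0 t \<omega> / p)"
      proof (rule AE_I2)
        fix \<omega>
        have "p * (norm (a (X x0 t \<omega>) t))\<^sup>2 \<le> \<beta>0 * V x0 t \<omega>"
          using p(2)[of "a (X x0 t \<omega>) t"] decrease[of "X x0 t \<omega>" t] sub[of \<omega>] unfolding V_def by linarith
        also have "\<dots> \<le> 1 * V x0 t \<omega>"
          unfolding V_def using \<beta>0 by (intro mult_right_mono pos_def_qform_nonneg[OF P]) simp
        finally show "norm ((norm (a (X x0 t \<omega>) t))\<^sup>2) \<le> norm (V x0 t \<omega> / p)"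
          using p(1) by (simp add: field_simps order.trans[OF _ abs_ge_self])
      qed
    qed (intro borel_measurable_power measurable_compose[OF _ borel_measurable_norm] meas XM)
    have neg: "qform P (- u) = qform P u" for u
      using qform_scaleR[of P "-1" u] by simp
    have bM: "(\<lambda>\<omega>. - (Ae e *v (?T *v X x0 t \<omega>))) \<in> borel_measurable H" for e
      by (intro borel_measurable_uminus borel_measurable_matrix_vector_mult XH)
    have b2: "integrable M (\<lambda>\<omega>. (norm (- (Ae e *v (?T *v X x0 t \<omega>))))\<^sup>2)" for e
      unfolding norm_minus_cancel
      by (intro integrable_norm_sq_matrix_mult z2 borel_measurable_matrix_vector_mult XM)
    let ?Y = "\<lambda>\<omega>. a (X x0 t \<omega>) t + (\<Sum>e\<in>EU. \<xi> e t \<omega> *\<^sub>R (- (Ae e *v (?T *v X x0 t \<omega>))))"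
    note moments = expectation_qform_random_combination[OF sym fin KH(1,2,3,4)
        link_noise_moments(1,2)[OF links] link_noise_moments(3,4)[OF links] meas[OF XH] a2 bM b2]
    have Yint: "integrable M (\<lambda>\<omega>. qform P (?Y \<omega>))"
      by (rule moments(1))
    have aq: "integrable M (\<lambda>\<omega>. qform P (a (X x0 t \<omega>) t))"
      unfolding qform_def by (intro integrable_inner_matrix meas XM a2)
    have bq: "integrable M (\<lambda>\<omega>. qform P (Ae e *v (?T *v X x0 t \<omega>)))" for e
      unfolding qform_def
      by (intro integrable_inner_matrix integrable_norm_sq_matrix_mult borel_measurable_matrix_vector_mult XM z2)
    have "expectation (\<lambda>\<omega>. qform P (?Y \<omega>)) = expectation (\<lambda>\<omega>. qform P (a (X x0 t \<omega>) t))
        + (\<Sum>e\<in>EU. (\<sigma> e)\<^sup>2 * expectation (\<lambda>\<omega>. qform P (Ae e *v (?T *v X x0 t \<omega>))))"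
      using moments(2) by (simp only: neg)
    also have "\<dots> = expectation (\<lambda>\<omega>. qform P (a (X x0 t \<omega>) t)
        + (\<Sum>e\<in>EU. (\<sigma> e)\<^sup>2 * qform P (Ae e *v (?T *v X x0 t \<omega>))))"
      by (simp add: aq bq)
    also have "\<dots> \<le> expectation (\<lambda>\<omega>. \<beta>0 * V x0 t \<omega>)"
      using aq bq VI decrease by (intro integral_mono) (auto simp: V_def)
    finally have Y: "expectation (\<lambda>\<omega>. qform P (?Y \<omega>)) \<le> \<beta>0 * expectation (V x0 t)" by simp
    have young: "V x0 (Suc t) \<omega> \<le> (1 + \<epsilon>) * qform P (?Y \<omega>) + (1 + 1 / \<epsilon>) * qform P (?T *v v t \<omega>)" for \<omega>
      unfolding V_def dynamics by (rule qform_young[OF P \<epsilon>(1)])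
    have bound: "integrable M (\<lambda>\<omega>. (1 + \<epsilon>) * qform P (?Y \<omega>) + (1 + 1 / \<epsilon>) * qform P (?T *v v t \<omega>))"
      using Yint noise_bound(1) by auto
    have V': "integrable M (V x0 (Suc t))"
    proof (rule Bochner_Integration.integrable_bound[OF bound])
      show "V x0 (Suc t) \<in> borel_measurable M"
        unfolding V_def by (intro borel_measurable_qform borel_measurable_matrix_vector_mult XM)
      show "AE \<omega> in M. norm (V x0 (Suc t) \<omega>)
          \<le> norm ((1 + \<epsilon>) * qform P (?Y \<omega>) + (1 + 1 / \<epsilon>) * qform P (?T *v v t \<omega>))"
        using young pos_def_qform_nonneg[OF P]
        by (intro AE_I2) (smt (verit) V_def real_norm_def)
    qed
    have "expectation (V x0 (Suc t))
        \<le> expectation (\<lambda>\<omega>. (1 + \<epsilon>) * qform P (?Y \<omega>) + (1 + 1 / \<epsilon>) * qform P (?T *v v t \<omega>))"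
      by (rule integral_mono[OF V' bound young])
    also have "\<dots> = (1 + \<epsilon>) * expectation (\<lambda>\<omega>. qform P (?Y \<omega>))
        + (1 + 1 / \<epsilon>) * expectation (\<lambda>\<omega>. qform P (?T *v v t \<omega>))"
      using Yint noise_bound(1) by simp
    also have "\<dots> \<le> (1 + \<epsilon>) * (\<beta>0 * expectation (V x0 t)) + (1 + 1 / \<epsilon>) * (\<kappa> * mat_norm Rv)"
      using \<epsilon>(1) by (intro add_mono mult_left_mono Y noise_bound(2)) auto
    also have "(1 + \<epsilon>) * (\<beta>0 * expectation (V x0 t)) = \<beta> * expectation (V x0 t)"
      using \<epsilon>(2) by (simp add: mult.assoc[symmetric])
    finally show ?thesis using V' by blast
  qed

  have VI: "integrable M (V x0 t)" for x0 t
  proof (induction t)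
    case 0
    have "V x0 0 = (\<lambda>_. qform P (?T *v x0))" by (rule ext) (simp add: V_def X_def)
    then show ?case by simp
  qed (use step in blast)
  have EV0: "expectation (V x0 0) \<le> mat_norm P * (norm (?T *v x0))\<^sup>2" for x0
    using qform_upper[of P "?T *v x0"] prob_space by (simp add: V_def X_def)

  let ?n = "2 * real CARD('N)"
  define c where "c = mat_norm P / p"
  \<comment> \<open>The summand 1 only makes the constant positive when the others vanish.\<close>
  define c' where "c' = ?n / p * ((1 + 1 / \<epsilon>) * \<kappa> / (1 - \<beta>)) + 1"
  have c: "0 \<le> c" using p by (simp add: c_def mat_norm_nonneg)
  have c': "0 < c'" unfolding c'_def using p \<epsilon>(1) \<kappa> \<beta> by (intro add_nonneg_pos) auto

  have sq_V: "sq_dist (X x0 t \<omega>) k j \<le> ?n / p * V x0 t \<omega>" for x0 t \<omega> k j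
  proof -
    have "?n * (norm (?T *v X x0 t \<omega>))\<^sup>2 \<le> ?n * (V x0 t \<omega> / p)"
      using p by (intro mult_left_mono) (auto simp: V_def field_simps)
    with sq_dist_le_disagreement[OF diag, of "X x0 t \<omega>" k j] show ?thesis by simp
  qed
  have sqI: "integrable M (\<lambda>\<omega>. sq_dist (X x0 t \<omega>) k j)" for x0 t k j
  proof (rule Bochner_Integration.integrable_bound[OF integrable_mult_right[OF VI[of x0 t], of "?n / p"]])
    have "continuous_on UNIV (\<lambda>x :: real^('N \<times> 'n). sq_dist x k j)"
      unfolding sq_dist_def subsys_def
      by (intro continuous_on_power continuous_on_norm continuous_on_diff continuous_on_vec_lambda
          continuous_on_component continuous_on_id)
    then show "(\<lambda>\<omega>. sq_dist (X x0 t \<omega>) k j) \<in> borel_measurable M"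
      using XM by (rule borel_measurable_continuous_on)
    show "AE \<omega> in M. norm (sq_dist (X x0 t \<omega>) k j) \<le> norm (?n / p * V x0 t \<omega>)"
    proof (rule AE_I2)
      fix \<omega>
      have "0 \<le> sq_dist (X x0 t \<omega>) k j" by (simp add: sq_dist_def)
      with sq_V[of x0 t \<omega> k j] show "norm (sq_dist (X x0 t \<omega>) k j) \<le> norm (?n / p * V x0 t \<omega>)"
        unfolding real_norm_def by linarith
    qed
  qed
  have bound: "expectation (\<lambda>\<omega>. sq_dist (X x0 t \<omega>) k j)
      \<le> sync_gain c (sq_dist x0) * \<beta> ^ t * initial_factor x0 k j + c' * mat_norm Rv" for x0 t k j
  proof -
    let ?d = "(1 + 1 / \<epsilon>) * (\<kappa> * mat_norm Rv)"
    have "0 \<le> ?d" using \<epsilon>(1) \<kappa> Rv by simp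
    then have geo: "expectation (V x0 t) \<le> \<beta> ^ t * expectation (V x0 0) + ?d / (1 - \<beta>)"
      using step VI by (intro geometric_recursion_bound[OF \<beta>]) auto
    have "expectation (\<lambda>\<omega>. sq_dist (X x0 t \<omega>) k j) \<le> expectation (\<lambda>\<omega>. ?n / p * V x0 t \<omega>)"
      by (intro integral_mono sqI integrable_mult_right VI sq_V)
    also have "\<dots> = ?n / p * expectation (V x0 t)" by simp
    also have "\<dots> \<le> ?n / p * (\<beta> ^ t * (mat_norm P * (norm (?T *v x0))\<^sup>2) + ?d / (1 - \<beta>))"
    proof (rule mult_left_mono)
      show "expectation (V x0 t) \<le> \<beta> ^ t * (mat_norm P * (norm (?T *v x0))\<^sup>2) + ?d / (1 - \<beta>)"
        using geo mult_left_mono[OF EV0[of x0], of "\<beta> ^ t"] zero_le_power[of \<beta> t] \<beta>(1) by linarith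
    qed (use p in simp)
    also have "\<dots> = \<beta> ^ t * (c * (?n * (norm (?T *v x0))\<^sup>2)) + (c' - 1) * mat_norm Rv"
    proof -
      have "n / p * (b * (m * y) + e * (k * r) / q) = b * (m / p * (n * y)) + (n / p * (e * k / q) + 1 - 1) * r"
        for n b m y e k r q :: real
        by (simp add: distrib_left mult_ac)
      then show ?thesis unfolding c_def c'_def .
    qed
    also have "\<dots> \<le> \<beta> ^ t * (sync_gain c (sq_dist x0) * initial_factor x0 k j) + c' * mat_norm Rv"
      unfolding norm_disagreement[OF diag]
      using \<beta> Rv by (intro add_mono mult_left_mono sync_gain_bound[OF c] mult_right_mono) auto
    finally show ?thesis by (simp add: mult_ac)
  qed
  show ?thesis
    unfolding ms_exp_synchronizing_def X_def[symmetric]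
    by (rule exI[of _ \<beta>], rule exI[of _ c'], rule exI[of _ "sync_gain c (\<lambda>_ _. 0)"], rule exI[of _ "sync_gain c"])
       (use \<beta> c' sync_gain_pos[OF c] sqI bound in blast)
qed

end
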